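(* Let $b\in\omega$ with $b\geq 2$. Then for every positive real $\varepsilon$ there exists a positive integer $t=t(\varepsilon)$ such that for every positive integer $K$ and every coloring (i.e. arbitrary map) $c:C^{\uparrow}_{\mathrm{sur}}(b^\omega)\to K=\{0,\dots,K-1\}$ there exist $h\in C^{\uparrow}_{\mathrm{sur}}(b^\omega)$ and $B\subseteq K$ with at most $t$ elements such that for every $f\in C^{\uparrow}_{\mathrm{sur}}(b^\omega)$ there exists $g\in C^{\uparrow}_{\mathrm{sur}}(b^\omega)$ satisfying $\rho_\infty(g,f\circ h)<\varepsilon$ and $c(g)\in B$. In particular, $t=t(\varepsilon)=t_{b^k-1}$ with $k=\lfloor\log_2(1/\varepsilon)\rfloor+1$, where $(t_j)_{j\ge1}$ is the sequence of odd tangent numbers.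
   Context: $\omega=\{0,1,2,\dots\}$ and $n\in\omega$ is identified with $\{0,\dots,n-1\}$. $b^\omega$ is the set of infinite sequences with values in $\{0,\dots,b-1\}$. For distinct $x,y\in b^\omega$, $\rho_b(x,y)=2^{-n_0}$ with $n_0=\min\{n:x(n)\neq y(n)\}$ (and $\rho_b(x,x)=0$); this makes $b^\omega$ a compact metric space. The lexicographic linear order is: $x\leq_{\mathrm{lex}}y$ iff $x=y$ or $x(n_0)<y(n_0)$ with $n_0=\min\{n:x(n)\neq y(n)\}$. $C^{\uparrow}_{\mathrm{sur}}(b^\omega)$ is the set of all maps $f:b^\omega\to b^\omega$ that are continuous, onto and nondecreasing ($x\leq_{\mathrm{lex}}y$ implies $f(x)\leq_{\mathrm{lex}}f(y)$), with metric $\rho_\infty(f,g)=\sup\{\rho_b(f(x),g(x)):x\in b^\omega\}$. The odd tangent numbers are $t_j=\tan^{(2j-1)}(0)$, the value at $0$ of the $(2j-1)$-th derivative of $\tan$, for each positive integer $j$.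
   Formalization: The explicit value t = t_{b^k-1} is asserted only for ε ≤ 1; for ε > 1 one has k ≤ 0, so t_{b^k-1} is undefined, and only the existence of a positive integer t is claimed. *)

theory Defs
  imports "HOL-Analysis.Analysis"
begin

definition seqs :: "nat \<Rightarrow> (nat \<Rightarrow> nat) set" where
  "seqs b = (UNIV \<rightarrow> {..<b})"

definition first_diff :: "(nat \<Rightarrow> nat) \<Rightarrow> (nat \<Rightarrow> nat) \<Rightarrow> nat" where
  "first_diff x y = (LEAST n. x n \<noteq> y n)"

text \<open>The formula for the metric does not involve the alphabet size, so one function
  serves all the spaces \<open>seqs b\<close>.\<close>

definition rho :: "(nat \<Rightarrow> nat) \<Rightarrow> (nat \<Rightarrow> nat) \<Rightarrow> real" where
  "rho x y = (if x = y then 0 else (1 / 2) ^ first_diff x y)"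

definition lex_le :: "(nat \<Rightarrow> nat) \<Rightarrow> (nat \<Rightarrow> nat) \<Rightarrow> bool" where
  "lex_le x y \<longleftrightarrow> x = y \<or> x (first_diff x y) < y (first_diff x y)"

lemma first_diff_neq: "x \<noteq> y \<Longrightarrow> x (first_diff x y) \<noteq> y (first_diff x y)"
  unfolding first_diff_def by (rule LeastI_ex) auto

lemma first_diff_eq: "n < first_diff x y \<Longrightarrow> x n = y n"
  unfolding first_diff_def using not_less_Least by blast

lemma first_diff_commute: "first_diff x y = first_diff y x"
  unfolding first_diff_def by metis

lemma Metric_space_seqs: "Metric_space (seqs b) rho"
proof
  fix x y z :: "nat \<Rightarrow> nat"
  show "0 \<le> rho x y" by (simp add: rho_def)
  show "rho x y = rho y x" by (simp add: rho_def first_diff_commute)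
  show "rho x y = 0 \<longleftrightarrow> x = y" by (simp add: rho_def)
  show "rho x z \<le> rho x y + rho y z"
  proof (cases "x = y \<or> y = z \<or> x = z")
    case True
    then show ?thesis by (auto simp: rho_def)
  next
    case False
    have "min (first_diff x y) (first_diff y z) \<le> first_diff x z"
      using False first_diff_neq first_diff_eq by (metis min_less_iff_conj not_le)
    then have "(1 / 2 :: real) ^ first_diff x z \<le> (1 / 2) ^ min (first_diff x y) (first_diff y z)"
      by (intro power_decreasing) auto
    also have "\<dots> \<le> (1 / 2) ^ first_diff x y + (1 / 2) ^ first_diff y z"
      by (simp add: min_def)
    finally show ?thesis using False by (simp add: rho_def)
  qed
qed

text \<open>Maps are taken extensional (\<open>undefined\<close> outside \<open>seqs b\<close>), so that the elements of
  \<open>C_sur_mono b\<close> correspond one-to-one to the maps on \<open>seqs b\<close>; otherwise a colouring could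
  depend on irrelevant values outside \<open>seqs b\<close>.\<close>

definition C_sur_mono :: "nat \<Rightarrow> ((nat \<Rightarrow> nat) \<Rightarrow> (nat \<Rightarrow> nat)) set" where
  "C_sur_mono b = {f \<in> seqs b \<rightarrow>\<^sub>E seqs b.
     continuous_map (Metric_space.mtopology (seqs b) rho) (Metric_space.mtopology (seqs b) rho) f \<and>
     f ` seqs b = seqs b \<and>
     (\<forall>x\<in>seqs b. \<forall>y\<in>seqs b. lex_le x y \<longrightarrow> lex_le (f x) (f y))}"

definition rho_sup :: "nat \<Rightarrow> ((nat \<Rightarrow> nat) \<Rightarrow> (nat \<Rightarrow> nat)) \<Rightarrow> ((nat \<Rightarrow> nat) \<Rightarrow> (nat \<Rightarrow> nat)) \<Rightarrow> real" where
  "rho_sup b f g = (SUP x\<in>seqs b. rho (f x) (g x))"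

text \<open>The supremum is over a nonempty bounded set of reals when \<open>b > 0\<close>, hence a genuine one.\<close>

lemma seqs_nonempty: "b > 0 \<Longrightarrow> seqs b \<noteq> {}"
  unfolding seqs_def by auto

lemma bdd_above_rho: "bdd_above ((\<lambda>x. rho (f x) (g x)) ` A)"
  by (rule bdd_aboveI[of _ 1]) (auto simp: rho_def power_le_one)

text \<open>Used for \<open>j \<ge> 1\<close> only; the subtraction on \<open>nat\<close> truncates at \<open>j = 0\<close>.\<close>

definition odd_tangent :: "nat \<Rightarrow> real" where
  "odd_tangent j = (deriv ^^ (2 * j - 1)) tan 0"

end

theory Submission
  imports Defs "HOL-Library.Sublist" "HOL-Computational_Algebra.Polynomial"
begin

text \<open>A map in \<open>C_sur_mono b\<close> is determined by how it pulls back the proper clopen cuts of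
  \<open>seqs b\<close>.  These cuts form a countable dense linear order, and \<open>g\<close> is within \<open>2^-k\<close> of
  \<open>f \<circ> h\<close> as soon as \<open>g\<close> and \<open>f \<circ> h\<close> pull back the \<open>b^k - 1\<close> cuts separating the cylinders of length \<open>k\<close> to the same
  cuts.  So a colouring of maps becomes a colouring of \<open>n\<close>-element sets of rationals with
  \<open>n = b^k - 1\<close>, and the theorem is the dual of Devlin's theorem that every finite colouring of these
  sets takes at most \<open>tan_num (2 * n - 1)\<close> values on some copy of the rationals.

  Devlin's theorem follows from Milliken's theorem on strong subtrees of the binary tree: in a
  suitably sparse copy of the rationals among the nodes, all sets of the same type sit in the same
  way inside strong subtrees of height \<open>2n - 1\<close>, and the types are the increasing full binary trees
  with \<open>2n - 1\<close> nodes, which are counted by the tangent numbers.  Milliken's theorem is obtained by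
  fusion from the Carlson--Simpson theorem on left variable words, and the latter from idempotents
  of the semigroup of ultrafilters on words.\<close>

text \<open>The conclusion is only approximate because \<open>c\<close> need not depend on the
  pulled back cuts alone. A set of n cuts receives the colour of one arbitrarily chosen map that
  pulls the level cuts back to it; the \<open>g\<close> of the theorem is the map chosen for the set
  belonging to f o h, and need not be f o h.

  The number 2n - 1 counts n diverging words together with their n - 1 meets. If these have pairwise
  different lengths, ranking the lengths turns the tree of meets into a binary tree with labels
  increasing away from the root. Deleting the least label leaves an ordered pair of such trees on
  complementary label sets, which is the recursion that tan' = 1 + tan^2 forces on the derivatives
  of tan at 0.

  In the full binary tree a set of words has more invariants: meets may share a level, and a word
  passing the level of a foreign meet may have either bit there. The sparse copy removes both: its
  critical levels are distinct, and all bits at foreign meets are False.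

  Variable words have to begin with the variable because in a strong subtree the image of s followed
  by a must leave the image of s in direction a at once.\<close>

section \<open>Compact right topological semigroups\<close>

lemma compact_imp_closed_bool_funs:
  fixes S :: "('a \<Rightarrow> bool) set"
  assumes "compact S" shows "closed S"
proof -
  have "Hausdorff_space (product_topology (\<lambda>i::'a. euclidean :: bool topology) UNIV)"
    unfolding Hausdorff_space_product_topology
    by (simp add: Hausdorff_space_def disjnt_def open_discrete)
      (metis Int_empty_left Int_insert_left insertI1 singletonD)
  then have "Hausdorff_space (euclidean :: ('a \<Rightarrow> bool) topology)"
    by (simp add: euclidean_product_topology)
  then show ?thesis
    using assms compactin_imp_closedin[of euclidean S] by (simp add: compactin_euclidean_iff)
qed

lemma compact_bool_funs: "compact (UNIV :: ('a \<Rightarrow> bool) set)"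
proof -
  have "compact_space (euclidean :: bool topology)"
    by (simp add: compact_space_def finite_imp_compact)
  then have "compact_space (product_topology (\<lambda>i::'a. euclidean :: bool topology) UNIV)"
    by (simp add: compact_space_product_topology del: compactin_euclidean_iff)
  then have "compact_space (euclidean :: ('a \<Rightarrow> bool) topology)"
    by (simp add: euclidean_product_topology)
  then show ?thesis
    by (simp add: compact_space_def)
qed

text \<open>Zorn's lemma for reverse inclusion. A finite subfamily of a chain has a least member, so
  compactness makes the intersection of a chain nonempty; this is why \<open>Int\<close> may
  presuppose nonemptiness.\<close>

lemma minimal_compact:
  fixes P :: "'a::topological_space set \<Rightarrow> bool"
  assumes haus: "\<And>S::'a set. compact S \<Longrightarrow> closed S"
    and K: "P K" and P: "\<And>S. P S \<Longrightarrow> compact S \<and> S \<noteq> {}"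
    and Int: "\<And>\<C>. \<C> \<noteq> {} \<Longrightarrow> (\<And>S. S \<in> \<C> \<Longrightarrow> P S) \<Longrightarrow> \<Inter>\<C> \<noteq> {} \<Longrightarrow> P (\<Inter>\<C>)"
  shows "\<exists>S. P S \<and> (\<forall>T. P T \<longrightarrow> T \<subseteq> S \<longrightarrow> T = S)"
proof -
  have "\<exists>m\<in>Collect P. \<forall>a\<in>Collect P. m \<supseteq> a \<longrightarrow> a = m"
  proof (rule predicate_Zorn)
    show "partial_order_on (Collect P) (relation_of (\<supseteq>) (Collect P))"
      by (auto simp: partial_order_on_def preorder_on_def relation_of_def refl_on_def trans_def antisym_def)
  next
    fix \<C> assume "\<C> \<in> Chains (relation_of (\<supseteq>) (Collect P))"
    then have C: "\<And>S. S \<in> \<C> \<Longrightarrow> P S" "\<And>S T. S \<in> \<C> \<Longrightarrow> T \<in> \<C> \<Longrightarrow> S \<subseteq> T \<or> T \<subseteq> S"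
      by (auto simp: Chains_def relation_of_def)
    show "\<exists>u\<in>Collect P. \<forall>a\<in>\<C>. a \<supseteq> u"
    proof (cases "\<C> = {}")
      case True
      then show ?thesis using K by auto
    next
      case False
      then obtain S0 where S0: "S0 \<in> \<C>" by blast
      have least: "\<exists>S\<in>F. \<Inter>F = S" if "finite F" "F \<noteq> {}" "F \<subseteq> \<C>" for F
        using that
      proof (induction F rule: finite_ne_induct)
        case (insert S F)
        then obtain T where "T \<in> F" "\<Inter>F = T" by auto
        moreover have "\<Inter>(insert S F) = S \<inter> T" using \<open>\<Inter>F = T\<close> by simp
        moreover have "S \<inter> T = S \<or> S \<inter> T = T" using C(2)[of S T] insert.prems \<open>T \<in> F\<close> by blast
        ultimately show ?case by auto
      qed simp
      have "S0 \<inter> \<Inter>\<C> \<noteq> {}"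
      proof (rule compact_imp_fip)
        show "compact S0" using S0 C P by blast
        show "closed T" if "T \<in> \<C>" for T using that C P haus by blast
        fix F assume F: "finite F" "F \<subseteq> \<C>"
        then obtain S where "S \<in> insert S0 F" "\<Inter>(insert S0 F) = S"
          using least[of "insert S0 F"] S0 by auto
        then show "S0 \<inter> \<Inter>F \<noteq> {}" using P C S0 F by auto
      qed
      then have "P (\<Inter>\<C>)" using Int[OF False] C by blast
      then show ?thesis by blast
    qed
  qed
  then show ?thesis by blast
qed

text \<open>Continuity is demanded in the left factor only, as for products of ultrafilters. The
  Hausdorff property enters in the form \<open>haus\<close>, which also yields closed
  singletons.\<close>

locale compact_semigroup =
  fixes X :: "'a::topological_space set" and m :: "'a \<Rightarrow> 'a \<Rightarrow> 'a" (infixl \<open>\<cdot>\<close> 70)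
  assumes haus: "\<And>S::'a set. compact S \<Longrightarrow> closed S"
    and compact: "compact X" and nonempty: "X \<noteq> {}"
    and closed: "p \<in> X \<Longrightarrow> q \<in> X \<Longrightarrow> p \<cdot> q \<in> X"
    and assoc: "p \<in> X \<Longrightarrow> q \<in> X \<Longrightarrow> r \<in> X \<Longrightarrow> (p \<cdot> q) \<cdot> r = p \<cdot> (q \<cdot> r)"
    and cont: "q \<in> X \<Longrightarrow> continuous_on X (\<lambda>p. p \<cdot> q)"
begin

lemma compact_right_translate:
  assumes "compact S" "S \<subseteq> X" "q \<in> X" shows "compact ((\<lambda>p. p \<cdot> q) ` S)"
  using assms cont by (meson compact_continuous_image continuous_on_subset)

text \<open>The Ellis-Numakura lemma. A minimal compact subsemigroup T satisfies T e = T for every e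
  in T. Hence the p in T with p e = e form a nonempty compact subsemigroup, which is T by minimality
  and so contains e.\<close>

lemma idempotent_exists:
  assumes S: "compact S" "S \<noteq> {}" "S \<subseteq> X" and sub: "\<And>p q. p \<in> S \<Longrightarrow> q \<in> S \<Longrightarrow> p \<cdot> q \<in> S"
  shows "\<exists>e\<in>S. e \<cdot> e = e"
proof -
  define P where "P T \<longleftrightarrow> compact T \<and> T \<noteq> {} \<and> T \<subseteq> X \<and> T \<subseteq> S \<and> (\<forall>p\<in>T. \<forall>q\<in>T. p \<cdot> q \<in> T)" for T
  have "\<exists>T. P T \<and> (\<forall>T'. P T' \<longrightarrow> T' \<subseteq> T \<longrightarrow> T' = T)"
  proof (rule minimal_compact[OF haus])
    show "P S" using assms by (auto simp: P_def)
    show "compact S \<and> S \<noteq> {}" if "P S" for S using that by (simp add: P_def)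
    fix \<C> assume C: "\<C> \<noteq> {}" "\<And>S. S \<in> \<C> \<Longrightarrow> P S" "\<Inter>\<C> \<noteq> {}"
    have "compact (\<Inter>\<C>)"
    proof -
      obtain S0 where S0: "S0 \<in> \<C>" using C by blast
      have "closed (\<Inter>\<C>)" using C haus by (intro closed_Inter) (auto simp: P_def)
      then have "compact (S0 \<inter> \<Inter>\<C>)" using C S0 by (intro compact_Int_closed) (auto simp: P_def)
      then show ?thesis using S0 by (simp add: Inf_lower inf.absorb2)
    qed
    then show "P (\<Inter>\<C>)" using C unfolding P_def by blast
  qed
  then obtain T where T: "P T" and min: "\<And>T'. P T' \<Longrightarrow> T' \<subseteq> T \<Longrightarrow> T' = T"
    by blast
  then obtain e where e: "e \<in> T" by (auto simp: P_def)
  have eX: "e \<in> X" using e T by (auto simp: P_def)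
  have "(\<lambda>p. p \<cdot> e) ` T = T"
  proof (rule min)
    show "(\<lambda>p. p \<cdot> e) ` T \<subseteq> T" using T e by (auto simp: P_def)
    moreover have "p \<cdot> e \<cdot> (q \<cdot> e) \<in> (\<lambda>p. p \<cdot> e) ` T" if "p \<in> T" "q \<in> T" for p q
    proof -
      have "p \<in> X" "q \<in> X" "p \<cdot> e \<in> X" using that T e closed by (auto simp: P_def)
      then have "p \<cdot> e \<cdot> (q \<cdot> e) = (p \<cdot> e \<cdot> q) \<cdot> e" using assoc[of "p \<cdot> e" q e] eX by simp
      then show ?thesis using T e that by (auto simp: P_def)
    qed
    ultimately show "P ((\<lambda>p. p \<cdot> e) ` T)"
      using T e compact_right_translate[of T e] eX by (auto simp: P_def)
  qed
  then obtain d where d: "d \<in> T" "d \<cdot> e = e" using e by (metis imageE)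
  define T' where "T' = {p \<in> T. p \<cdot> e = e}"
  have "T' = T"
  proof (rule min)
    show "T' \<subseteq> T" by (auto simp: T'_def)
    have "continuous_on T (\<lambda>p. p \<cdot> e)" using cont[OF eX] T continuous_on_subset by (auto simp: P_def)
    moreover have "closed T" "closed {e}" using T haus by (auto simp: P_def)
    ultimately have "closed (T \<inter> (\<lambda>p. p \<cdot> e) -` {e})"
      by (simp add: continuous_closed_preimage)
    then have "compact (T \<inter> (T \<inter> (\<lambda>p. p \<cdot> e) -` {e}))" using T by (intro compact_Int_closed) (auto simp: P_def)
    moreover have "T \<inter> (T \<inter> (\<lambda>p. p \<cdot> e) -` {e}) = T'" by (auto simp: T'_def)
    ultimately have "compact T'" by simp
    moreover have "p \<cdot> q \<cdot> e = e" if "p \<in> T'" "q \<in> T'" for p q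
    proof -
      have "p \<in> X" "q \<in> X" using that T by (auto simp: P_def T'_def)
      then show ?thesis using that assoc eX by (simp add: T'_def)
    qed
    ultimately show "P T'" using T d by (auto simp: P_def T'_def)
  qed
  then have "e \<cdot> e = e" using e by (auto simp: T'_def)
  moreover have "e \<in> S" using e T unfolding P_def by blast
  ultimately show ?thesis by blast
qed

text \<open>For an idempotent e in a minimal left ideal L, the set L e is a compact left ideal
  inside L, hence all of L. So every p in L has the form q e, and p e = q e e = p.\<close>

lemma minimal_left_ideal_exists:
  shows "\<exists>L. compact L \<and> L \<noteq> {} \<and> L \<subseteq> X \<and> (\<forall>p\<in>X. \<forall>q\<in>L. p \<cdot> q \<in> L) \<and>
    (\<forall>p\<in>L. \<forall>e\<in>L. e \<cdot> e = e \<longrightarrow> p \<cdot> e = p)"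
proof -
  define P where "P T \<longleftrightarrow> compact T \<and> T \<noteq> {} \<and> T \<subseteq> X \<and> (\<forall>p\<in>X. \<forall>q\<in>T. p \<cdot> q \<in> T)" for T
  have "\<exists>T. P T \<and> (\<forall>T'. P T' \<longrightarrow> T' \<subseteq> T \<longrightarrow> T' = T)"
  proof (rule minimal_compact[OF haus])
    show "P X" using compact nonempty closed by (auto simp: P_def)
    show "compact S \<and> S \<noteq> {}" if "P S" for S using that by (simp add: P_def)
    fix \<C> assume C: "\<C> \<noteq> {}" "\<And>S. S \<in> \<C> \<Longrightarrow> P S" "\<Inter>\<C> \<noteq> {}"
    have "compact (\<Inter>\<C>)"
    proof -
      obtain S0 where S0: "S0 \<in> \<C>" using C by blast
      have "closed (\<Inter>\<C>)" using C haus by (intro closed_Inter) (auto simp: P_def)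
      then have "compact (S0 \<inter> \<Inter>\<C>)" using C S0 by (intro compact_Int_closed) (auto simp: P_def)
      then show ?thesis using S0 by (simp add: Inf_lower inf.absorb2)
    qed
    then show "P (\<Inter>\<C>)" using C unfolding P_def by blast
  qed
  then obtain L where L: "P L" and min: "\<And>T. P T \<Longrightarrow> T \<subseteq> L \<Longrightarrow> T = L"
    by blast
  have "p \<cdot> e = p" if "p \<in> L" "e \<in> L" "e \<cdot> e = e" for p e
  proof -
    have LX: "L \<subseteq> X" using L by (simp add: P_def)
    have "(\<lambda>p. p \<cdot> e) ` L = L"
    proof (rule min)
      show "(\<lambda>p. p \<cdot> e) ` L \<subseteq> L" using L that by (auto simp: P_def)
      moreover have "r \<cdot> (q \<cdot> e) \<in> (\<lambda>p. p \<cdot> e) ` L" if "r \<in> X" "q \<in> L" for q r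
      proof -
        have "q \<in> X" "e \<in> X" using LX that \<open>e \<in> L\<close> by auto
        then have "r \<cdot> (q \<cdot> e) = (r \<cdot> q) \<cdot> e" using assoc that by simp
        then show ?thesis using L that by (auto simp: P_def)
      qed
      ultimately show "P ((\<lambda>p. p \<cdot> e) ` L)"
        using L that LX compact_right_translate[of L e] by (auto simp: P_def)
    qed
    then obtain q where "q \<in> L" "p = q \<cdot> e" using \<open>p \<in> L\<close> by (metis imageE)
    then show ?thesis using assoc[of q e e] LX that by auto
  qed
  then show ?thesis using L unfolding P_def by (intro exI[of _ L]) blast
qed

end

section \<open>The Carlson--Simpson theorem\<close>

text \<open>Ultrafilters are encoded as Boolean functions on sets, so that the product topology is
  the Stone topology. The clause on complements also excludes the empty set.\<close>

definition ultra :: "('a set \<Rightarrow> bool) \<Rightarrow> bool" where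
  "ultra p \<longleftrightarrow> p UNIV \<and> (\<forall>A B. p (A \<inter> B) \<longleftrightarrow> p A \<and> p B) \<and> (\<forall>A. p (- A) \<longleftrightarrow> \<not> p A)"

text \<open>The extension of concatenation to the Stone-Cech compactification of the words; this
  order of nesting makes it continuous in \<open>p\<close>.\<close>

definition ultra_mult :: "('a list set \<Rightarrow> bool) \<Rightarrow> ('a list set \<Rightarrow> bool) \<Rightarrow> 'a list set \<Rightarrow> bool" (infixl \<open>\<odot>\<close> 70) where
  "(p \<odot> q) A \<longleftrightarrow> p {s. q {t. s @ t \<in> A}}"

definition ultra_map :: "('a \<Rightarrow> 'b) \<Rightarrow> ('a set \<Rightarrow> bool) \<Rightarrow> 'b set \<Rightarrow> bool" where
  "ultra_map f p A \<longleftrightarrow> p (f -` A)"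

lemma ultra_Int: "ultra p \<Longrightarrow> p (A \<inter> B) \<longleftrightarrow> p A \<and> p B"
  and ultra_Compl: "ultra p \<Longrightarrow> p (- A) \<longleftrightarrow> \<not> p A"
  and ultra_UNIV: "ultra p \<Longrightarrow> p UNIV"
  by (auto simp: ultra_def)

lemma ultra_mono: "ultra p \<Longrightarrow> p A \<Longrightarrow> A \<subseteq> B \<Longrightarrow> p B"
  by (metis inf.absorb_iff1 ultra_Int)

lemma ultra_nonempty: "ultra p \<Longrightarrow> p A \<Longrightarrow> A \<noteq> {}"
  by (metis Compl_empty_eq ultra_Compl ultra_UNIV)

lemma ultra_finite_Inter:
  assumes "ultra p" and "finite I" "\<And>i. i \<in> I \<Longrightarrow> p (A i)"
  shows "p (\<Inter>i\<in>I. A i)"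
  using assms(2,3) by (induction I rule: finite_induct) (auto simp: assms(1) ultra_UNIV ultra_Int)

lemma ultra_finite_cover:
  assumes p: "ultra p" and "finite I" "p (\<Union>i\<in>I. A i)"
  shows "\<exists>i\<in>I. p (A i)"
proof (rule ccontr)
  assume neg: "\<not> ?thesis"
  have "p (- A i)" if "i \<in> I" for i
    by (rule ultra_Compl[OF p, THEN iffD2]) (use neg that in blast)
  then have "p (\<Inter>i\<in>I. - A i)" by (rule ultra_finite_Inter[OF p assms(2)])
  moreover have "(\<Inter>i\<in>I. - A i) = - (\<Union>i\<in>I. A i)" by auto
  ultimately have "p (- (\<Union>i\<in>I. A i))" by (simp only:)
  then show False using ultra_Compl[OF p, of "\<Union>i\<in>I. A i"] assms(3) by simp
qed

lemma ultra_principal: "ultra (\<lambda>A. a \<in> A)"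
  by (auto simp: ultra_def)

lemma ultra_ultra_map: "ultra p \<Longrightarrow> ultra (ultra_map f p)"
  by (auto simp: ultra_def ultra_map_def vimage_Compl)

lemma ultra_ultra_mult:
  assumes "ultra p" "ultra q" shows "ultra (p \<odot> q)"
proof -
  have 1: "{t. s @ t \<in> A \<inter> B} = {t. s @ t \<in> A} \<inter> {t. s @ t \<in> B}" "{t. s @ t \<in> - A} = - {t. s @ t \<in> A}"
    for s :: "'a list" and A B by auto
  have 2: "{s. P s \<and> Q s} = {s. P s} \<inter> {s. Q s}" "{s. \<not> P s} = - {s. P s}"
    for P Q :: "'a list \<Rightarrow> bool" by auto
  show ?thesis
    unfolding ultra_def ultra_mult_def 1
    using assms by (simp add: ultra_Int ultra_Compl 2 ultra_UNIV)
qed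

lemma ultra_mult_assoc: "p \<odot> q \<odot> r = p \<odot> (q \<odot> r)"
  by (simp add: fun_eq_iff ultra_mult_def)

lemma ultra_map_mult:
  assumes "\<And>s t. f (s @ t) = f s @ f t"
  shows "ultra_map f (p \<odot> q) = ultra_map f p \<odot> ultra_map f q"
  by (simp add: fun_eq_iff ultra_mult_def ultra_map_def vimage_def assms)

lemma closed_eval: "closed {p :: 'a \<Rightarrow> bool. p A}" and closed_not_eval: "closed {p :: 'a \<Rightarrow> bool. \<not> p A}"
proof -
  have "closed ((\<lambda>p :: 'a \<Rightarrow> bool. p A) -` B)" for B
    by (intro closed_vimage continuous_on_product_coordinates) (simp add: closed_def open_discrete)
  from this[of "{True}"] this[of "{False}"]
  show "closed {p :: 'a \<Rightarrow> bool. p A}" "closed {p :: 'a \<Rightarrow> bool. \<not> p A}"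
    by (simp_all add: vimage_def)
qed

text \<open>Each instance of an ultrafilter axiom involves finitely many coordinates, and a
  condition on one coordinate is clopen.\<close>

lemma compact_ultra: "compact {p :: 'a set \<Rightarrow> bool. ultra p}"
proof -
  have "closed {p :: 'a set \<Rightarrow> bool. ultra p}"
  proof -
    have Int: "{p :: 'a set \<Rightarrow> bool. p (A \<inter> B) \<longleftrightarrow> p A \<and> p B} =
      ({p. \<not> p (A \<inter> B)} \<union> ({p. p A} \<inter> {p. p B})) \<inter> ({p. p (A \<inter> B)} \<union> ({p. \<not> p A} \<union> {p. \<not> p B}))" for A B
      by auto
    have Compl: "{p :: 'a set \<Rightarrow> bool. p (- A) \<longleftrightarrow> \<not> p A} =
      ({p. p (- A)} \<inter> {p. \<not> p A}) \<union> ({p. \<not> p (- A)} \<inter> {p. p A})" for A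
      by auto
    have "closed {p :: 'a set \<Rightarrow> bool. p (A \<inter> B) \<longleftrightarrow> p A \<and> p B}"
      "closed {p :: 'a set \<Rightarrow> bool. p (- A) \<longleftrightarrow> \<not> p A}" for A B
      unfolding Int Compl by (intro closed_Int closed_Un closed_eval closed_not_eval)+
    then show ?thesis
      unfolding ultra_def by (intro closed_Collect_conj closed_Collect_all closed_eval)
  qed
  then show ?thesis using compact_Int_closed[OF compact_bool_funs] by (metis Int_UNIV_left)
qed

interpretation ultra: compact_semigroup "{p. ultra p}" ultra_mult
proof
  fix p q r :: "'a list set \<Rightarrow> bool"
  show "compact {p :: 'a list set \<Rightarrow> bool. ultra p}" by (rule compact_ultra)
  show "{p :: 'a list set \<Rightarrow> bool. ultra p} \<noteq> {}"
    by (rule ex_in_conv[THEN iffD1], rule exI, rule CollectI, rule ultra_principal)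
  show "closed S" if "compact S" for S :: "('a list set \<Rightarrow> bool) set"
    using that by (rule compact_imp_closed_bool_funs)
  show "continuous_on {p. ultra p} (\<lambda>p. p \<odot> q)"
  proof (rule continuous_on_coordinatewise_then_product)
    \<comment> \<open>This coordinate of the product is itself a coordinate of \<open>p\<close>, at
      a set that depends on \<open>q\<close> and \<open>A\<close> only.\<close>
    show "continuous_on {p. ultra p} (\<lambda>p. (p \<odot> q) A)" for A
      unfolding ultra_mult_def
      by (rule continuous_on_subset[OF continuous_on_product_coordinates subset_UNIV])
  qed
  show "p \<odot> q \<in> {p. ultra p}" if "p \<in> {p. ultra p}" "q \<in> {p. ultra p}"
    using that by (simp add: ultra_ultra_mult)
  show "p \<odot> q \<odot> r = p \<odot> (q \<odot> r)" by (rule ultra_mult_assoc)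
qed

text \<open>A word over \<^typ>\<open>'a option\<close> is a variable word, \<^const>\<open>None\<close> being the variable.\<close>

definition subst :: "'a \<Rightarrow> 'a option list \<Rightarrow> 'a list" where
  "subst a w = map (case_option a id) w"

fun subst_all :: "(nat \<Rightarrow> 'a option list) \<Rightarrow> 'a list \<Rightarrow> 'a list" where
  "subst_all w [] = []"
| "subst_all w (a # as) = subst a (w 0) @ subst_all (w \<circ> Suc) as"

lemma subst_all_snoc: "subst_all w (as @ [a]) = subst_all w as @ subst a (w (length as))"
  by (induction as arbitrary: w) auto

lemma length_subst_all: "length (subst_all w as) = (\<Sum>i<length as. length (w i))"
  by (induction as rule: rev_induct) (auto simp: subst_all_snoc subst_def)

lemma subst_append: "subst a (v @ w) = subst a v @ subst a w"
  by (simp add: subst_def)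

text \<open>The ultrafilters \<open>subst a V\<close> and \<open>U\<close> of the proof all lie in one minimal left ideal \<open>L\<close>,
  where every idempotent is a right identity; hence \<open>U \<odot> subst a V = U\<close> and
  \<open>subst a V \<odot> subst b V = subst a V\<close>.  The factor \<open>U\<close> in \<open>J\<close> moves the substitutions into \<open>L\<close>.\<close>

lemma Carlson_Simpson:
  fixes c :: "'a list \<Rightarrow> 'c"
  assumes A: "finite A" and c: "finite (range c)"
  shows "\<exists>w0 w col. (\<forall>i. \<exists>v. w i = None # v) \<and> (\<forall>as. set as \<subseteq> A \<longrightarrow> c (w0 @ subst_all w as) = col)"
proof -
  obtain L :: "('a list set \<Rightarrow> bool) set" where L0: "L \<noteq> {}" "L \<subseteq> {p. ultra p}"
    "\<forall>p\<in>{p. ultra p}. \<forall>q\<in>L. p \<odot> q \<in> L" "\<forall>p\<in>L. \<forall>e\<in>L. e \<odot> e = e \<longrightarrow> p \<odot> e = p"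
    using ultra.minimal_left_ideal_exists[where 'a = 'a] by (elim exE conjE)
  have L1: "ultra p" if "p \<in> L" for p using subsetD[OF L0(2) that] by simp
  have L2: "p \<odot> q \<in> L" if "ultra p" "q \<in> L" for p q by (rule L0(3)[rule_format]) (simp_all add: that)
  have L3: "p \<odot> e = p" if "p \<in> L" "e \<in> L" "e \<odot> e = e" for p e by (rule L0(4)[rule_format, OF that])
  obtain U where U: "U \<in> L" using L0(1) by blast
  have uU: "ultra U" using U by (rule L1)
  define U' where "U' = ultra_map (map Some) U"
  have uU': "ultra U'" using uU by (simp add: U'_def ultra_ultra_map)
  \<comment> \<open>Concentration on words beginning with the variable is inherited from the left
    factor of a product, so \<open>X\<close> absorbs multiplication from the right. It will make the
    chosen words left variable words.\<close>
  define X where "X = {p :: 'a option list set \<Rightarrow> bool. ultra p} \<inter> {p. p (range (Cons None))}"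
  define J where "J = (\<lambda>p. p \<odot> U') ` X"
  have left: "p \<odot> q \<in> X" if "p \<in> X" "ultra q" for p q
  proof -
    have "p {s. q {t. s @ t \<in> range (Cons None)}}"
      by (rule ultra_mono[of p "range (Cons None)"]) (use that ultra_UNIV[of q] in \<open>auto simp: X_def\<close>)
    then show ?thesis using that using ultra_ultra_mult[of p q] by (simp add: X_def ultra_mult_def)
  qed
  have "compact X" unfolding X_def using compact_ultra closed_eval by (rule compact_Int_closed)
  then have "compact J" unfolding J_def
    using uU' by (intro ultra.compact_right_translate) (auto simp: X_def)
  moreover have "(\<lambda>A. [None] \<in> A) \<in> X" by (simp add: X_def ultra_principal)
  then have "J \<noteq> {}" by (auto simp: J_def)
  moreover have "J \<subseteq> X" using left uU' by (auto simp: J_def)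
  moreover have "p \<odot> q \<in> J" if pq: "p \<in> J" "q \<in> J" for p q
  proof -
    obtain p' q' where "p' \<in> X" "p = p' \<odot> U'" "q' \<in> X" "q = q' \<odot> U'" using pq by (auto simp: J_def)
    moreover from this have "p' \<odot> U' \<odot> q' \<in> X" using left uU' by (simp add: X_def)
    moreover have "p' \<odot> U' \<odot> (q' \<odot> U') = (p' \<odot> U' \<odot> q') \<odot> U'" by (simp add: ultra_mult_assoc)
    ultimately show ?thesis unfolding J_def by (metis imageI)
  qed
  moreover have "X \<subseteq> {p. ultra p}" by (auto simp: X_def)
  ultimately have "\<exists>V\<in>J. V \<odot> V = V"
    using subset_trans[of J X] by (intro ultra.idempotent_exists)
  then obtain V where V: "V \<in> J" "V \<odot> V = V" by blast
  have uV: "ultra V" and V_left: "V (range (Cons None))"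
    using V \<open>J \<subseteq> X\<close> by (auto simp: X_def)
  define T where "T a = ultra_map (subst a) V" for a
  \<comment> \<open>Substitution does nothing to the constant words that carry \<open>U'\<close>; so
    it sends \<open>V\<close> to a product with last factor \<open>U\<close>, and \<open>L\<close>
    is a left ideal.\<close>
  have TL: "T a \<in> L" for a
  proof -
    obtain p where p: "p \<in> X" "V = p \<odot> U'" using V by (auto simp: J_def)
    have "subst a (map Some s) = s" for s by (induction s) (simp_all add: subst_def)
    then have "map Some -` subst a -` B = B" for B by auto
    then have "ultra_map (subst a) U' = U"
      by (simp add: U'_def ultra_map_def fun_eq_iff)
    then have "T a = ultra_map (subst a) p \<odot> U"
      using p by (simp add: T_def ultra_map_mult subst_append)
    moreover have "ultra (ultra_map (subst a) p)" using p by (intro ultra_ultra_map) (simp add: X_def)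
    ultimately show ?thesis using L2[OF _ U] by simp
  qed
  have uT: "ultra (T a)" for a using TL by (rule L1)
  have absorb: "p \<odot> T a = p" if "p \<in> L" for p a
  proof (rule L3[OF that TL])
    show "T a \<odot> T a = T a" using V by (simp add: T_def ultra_map_mult[symmetric] subst_append)
  qed
  have "(\<Union>col\<in>range c. c -` {col}) = UNIV" by auto
  then have "\<exists>col\<in>range c. U (c -` {col})"
    using ultra_finite_cover[OF uU c, of "\<lambda>col. c -` {col}"] ultra_UNIV[OF uU] by simp
  then obtain col where col: "U (c -` {col})" by blast
  define P where "P = c -` {col}"
  \<comment> \<open>The invariant of the construction: the word has the right colour, and so have
    almost all its continuations in the sense of every \<open>T a\<close>.\<close>
  define good where "good s \<longleftrightarrow> s \<in> P \<and> (\<forall>a\<in>A. T a {t. s @ t \<in> P})" for s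
  have "U ({s. s \<in> P} \<inter> (\<Inter>a\<in>A. {s. T a {t. s @ t \<in> P}}))"
  proof -
    have "U {s. T a {t. s @ t \<in> P}}" for a
    proof -
      have "(U \<odot> T a) P" using absorb[OF U, of a] col by (simp add: P_def)
      then show ?thesis by (simp add: ultra_mult_def)
    qed
    then have "U (\<Inter>a\<in>A. {s. T a {t. s @ t \<in> P}})" using A by (intro ultra_finite_Inter[OF uU]) auto
    then show ?thesis using col by (simp add: ultra_Int[OF uU] P_def vimage_def)
  qed
  moreover have "{s. s \<in> P} \<inter> (\<Inter>a\<in>A. {s. T a {t. s @ t \<in> P}}) = Collect good"
    by (auto simp: good_def)
  ultimately have "U (Collect good)" by simp
  from ultra_nonempty[OF uU this] obtain w0 where w0: "good w0" by auto
  \<comment> \<open>One \<open>v\<close> has to serve all pairs of a word and a letter. As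
    \<open>T a \<odot> T b = T a\<close>, almost all continuations of a good word are good again;
    pulled back to \<open>V\<close>, this gives finitely many large sets with a common
    element.\<close>
  have extend: "\<exists>v. \<forall>s\<in>F. \<forall>a\<in>A. good (s @ subst a (None # v))" if F: "finite F" "\<forall>s\<in>F. good s" for F
  proof -
    have *: "T a {t. good (s @ t)}" if s: "good s" "a \<in> A" for s a
    proof -
      have "T a {t. T b {u. s @ t @ u \<in> P}}" if "b \<in> A" for b
      proof -
        have "(T a \<odot> T b) {t. s @ t \<in> P}" using absorb[OF TL, of a b] s by (simp add: good_def)
        then show ?thesis by (simp add: ultra_mult_def)
      qed
      then have "T a ({t. s @ t \<in> P} \<inter> (\<Inter>b\<in>A. {t. T b {u. s @ t @ u \<in> P}}))"
        using s A ultra_finite_Inter[OF uT A, of a "\<lambda>b. {t. T b {u. s @ t @ u \<in> P}}"]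
        by (simp add: ultra_Int[OF uT] good_def)
      moreover have "{t. s @ t \<in> P} \<inter> (\<Inter>b\<in>A. {t. T b {u. s @ t @ u \<in> P}}) = {t. good (s @ t)}"
        by (auto simp: good_def)
      ultimately show ?thesis by simp
    qed
    have "V (\<Inter>i\<in>F \<times> A. {w. good (fst i @ subst (snd i) w)})"
    proof (rule ultra_finite_Inter[OF uV])
      show "finite (F \<times> A)" using A F by simp
      show "V {w. good (fst i @ subst (snd i) w)}" if "i \<in> F \<times> A" for i
        using *[of "fst i" "snd i"] F that by (auto simp: T_def ultra_map_def vimage_def)
    qed
    then have "V (range (Cons None) \<inter> (\<Inter>i\<in>F \<times> A. {w. good (fst i @ subst (snd i) w)}))"
      using V_left by (intro ultra_Int[OF uV, THEN iffD2] conjI)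
    from ultra_nonempty[OF uV this]
    obtain w where w: "w \<in> range (Cons None)" "w \<in> (\<Inter>i\<in>F \<times> A. {w. good (fst i @ subst (snd i) w)})"
      by blast
    then obtain v where "w = None # v" by auto
    then have "good (s @ subst a (None # v))" if "s \<in> F" "a \<in> A" for s a
      using w(2) that by auto
    then show ?thesis by blast
  qed
  define pick where "pick F = (SOME v. \<forall>s\<in>F. \<forall>a\<in>A. good (s @ subst a (None # v)))" for F
  have pick: "\<forall>s\<in>F. \<forall>a\<in>A. good (s @ subst a (None # pick F))" if "finite F" "\<forall>s\<in>F. good s" for F
    unfolding pick_def by (rule someI_ex[OF extend[OF that]])
  \<comment> \<open>\<open>F n\<close> contains the results of all substitutions of n letters, so
    the next variable word does not depend on which letters were substituted.\<close>
  define F where "F = rec_nat {w0} (\<lambda>_ F. (\<lambda>(s,a). s @ subst a (None # pick F)) ` (F \<times> A))"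
  have F_simps: "F 0 = {w0}" "F (Suc n) = (\<lambda>(s,a). s @ subst a (None # pick (F n))) ` (F n \<times> A)" for n
    by (simp_all add: F_def)
  have F: "finite (F n)" "\<forall>s\<in>F n. good s" for n
  proof (induction n)
    case (Suc n)
    show "finite (F (Suc n))" using Suc A by (simp add: F_simps)
    show "\<forall>s\<in>F (Suc n). good s" using pick[OF Suc] by (auto simp: F_simps)
  qed (simp_all add: F_simps w0)
  define w where "w n = None # pick (F n)" for n
  have w: "w n = None # pick (F n)" for n by (simp add: w_def)
  have mem: "w0 @ subst_all w as \<in> F (length as)" if "set as \<subseteq> A" for as
    using that
  proof (induction as rule: rev_induct)
    case (snoc a as)
    then have "(w0 @ subst_all w as, a) \<in> F (length as) \<times> A" by auto
    from imageI[OF this, of "\<lambda>(s,a). s @ subst a (None # pick (F (length as)))"]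
    have "(w0 @ subst_all w as) @ subst a (None # pick (F (length as))) \<in> F (Suc (length as))"
      by (simp add: F_simps)
    then show ?case by (simp add: subst_all_snoc w[of "length as"])
  qed (simp add: F_simps)
  have "c (w0 @ subst_all w as) = col" if "set as \<subseteq> A" for as
    using mem[OF that] F(2)[of "length as"] by (auto simp: good_def P_def)
  moreover have "\<exists>v. w i = None # v" for i using w by blast
  ultimately show ?thesis by blast
qed

section \<open>Milliken's theorem\<close>

text \<open>A strong subtree of the full binary tree is represented by its level preserving enumeration.\<close>

definition strong_emb :: "(bool list \<Rightarrow> bool list) \<Rightarrow> bool" where
  "strong_emb \<phi> \<longleftrightarrow> (\<forall>s t. length s = length t \<longrightarrow> length (\<phi> s) = length (\<phi> t)) \<and>
    (\<forall>s a. prefix (\<phi> s @ [a]) (\<phi> (s @ [a])))"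

text \<open>The fixed value \<open>[]\<close> on the other levels lets restrictions be compared, and
  coloured, as total functions.\<close>

definition trunc :: "nat \<Rightarrow> (bool list \<Rightarrow> bool list) \<Rightarrow> bool list \<Rightarrow> bool list" where
  "trunc k \<phi> s = (if length s < k then \<phi> s else [])"

lemma strong_emb_length: "strong_emb \<phi> \<Longrightarrow> length s = length t \<Longrightarrow> length (\<phi> s) = length (\<phi> t)"
  unfolding strong_emb_def by blast

lemma strong_emb_step: "strong_emb \<phi> \<Longrightarrow> prefix (\<phi> s @ [a]) (\<phi> (s @ [a]))"
  unfolding strong_emb_def by blast

lemma strong_emb_prefix:
  assumes "strong_emb \<phi>" "prefix (s @ [a]) t"
  shows "prefix (\<phi> s @ [a]) (\<phi> t)"
proof -
  have "prefix (\<phi> s @ [a]) (\<phi> (s @ [a] @ u))" for u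
  proof (induction u rule: rev_induct)
    case Nil
    show ?case using strong_emb_step[OF assms(1)] by simp
  next
    case (snoc b u)
    have "prefix (\<phi> (s @ [a] @ u) @ [b]) (\<phi> ((s @ [a] @ u) @ [b]))"
      by (rule strong_emb_step[OF assms(1)])
    then have "prefix (\<phi> (s @ [a] @ u)) (\<phi> (s @ [a] @ u @ [b]))"
      by (metis append.assoc append_prefixD)
    with snoc show ?case by (rule prefix_order.trans)
  qed
  then show ?thesis using assms(2) by (auto simp: prefix_def)
qed

lemma strong_emb_id: "strong_emb (\<lambda>s. s)"
  by (simp add: strong_emb_def)

lemma strong_emb_comp:
  assumes "strong_emb \<phi>" "strong_emb \<psi>" shows "strong_emb (\<phi> \<circ> \<psi>)"
  unfolding strong_emb_def[of "\<phi> \<circ> \<psi>"] comp_apply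
  using strong_emb_length[OF assms(1)] strong_emb_length[OF assms(2)]
    strong_emb_prefix[OF assms(1) strong_emb_step[OF assms(2)]] by blast

lemma strong_emb_inj:
  assumes "strong_emb \<phi>" "length s = length t" "\<phi> s = \<phi> t"
  shows "s = t"
  using assms(2,3)
proof (induction s arbitrary: t rule: rev_induct)
  case (snoc a s)
  then obtain t' b where t: "t = t' @ [b]"
    by (metis length_0_conv rev_exhaust snoc_eq_iff_butlast)
  have "prefix (\<phi> s @ [a]) (\<phi> (s @ [a]))" by (rule strong_emb_step[OF assms(1)])
  moreover have "prefix (\<phi> t' @ [b]) (\<phi> (s @ [a]))"
    unfolding snoc.prems(2) t by (rule strong_emb_step[OF assms(1)])
  moreover have "length (\<phi> s) = length (\<phi> t')"
    using snoc t by (intro strong_emb_length[OF assms(1)]) simp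
  ultimately have "\<phi> s @ [a] = \<phi> t' @ [b]"
    by (auto simp: prefix_def)
  then show ?case using snoc.IH[of t'] snoc.prems t by simp
qed simp

lemma strong_emb_length_Suc:
  assumes "strong_emb \<phi>" "length t = Suc (length s)"
  shows "length (\<phi> s) < length (\<phi> t)"
proof -
  have "length (\<phi> t) = length (\<phi> (s @ [True]))"
    using assms(2) by (intro strong_emb_length[OF assms(1)]) simp
  have "prefix (\<phi> s @ [True]) (\<phi> (s @ [True]))" by (rule strong_emb_step[OF assms(1)])
  from prefix_length_le[OF this] show ?thesis using \<open>length (\<phi> t) = _\<close> by simp
qed

lemma strong_emb_length_mono:
  assumes "strong_emb \<phi>" "length s < length t"
  shows "length (\<phi> s) < length (\<phi> t)"
proof -
  have "length (\<phi> s) < length (\<phi> (replicate (Suc (length s + d)) True))" for d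
  proof (induction d)
    case 0
    show ?case using strong_emb_length_Suc[OF assms(1), of "replicate (Suc (length s)) True" s] by simp
  next
    case (Suc d)
    have "length (\<phi> (replicate (Suc (length s + d)) True)) < length (\<phi> (replicate (Suc (length s + Suc d)) True))"
      by (rule strong_emb_length_Suc[OF assms(1)]) simp
    with Suc show ?case by simp
  qed
  moreover obtain d where "length t = Suc (length s + d)" using less_imp_Suc_add[OF assms(2)] by blast
  ultimately have "length (\<phi> s) < length (\<phi> (replicate (length t) True))" by (simp only:)
  also have "\<dots> = length (\<phi> t)" by (rule strong_emb_length[OF assms(1)]) simp
  finally show ?thesis .
qed

text \<open>\<open>attach \<phi> s\<close> is the node above which an extension of the restriction of \<open>\<phi>\<close> to the levels
  below \<open>length s\<close> has to place \<open>s\<close>.\<close>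

definition attach :: "(bool list \<Rightarrow> bool list) \<Rightarrow> bool list \<Rightarrow> bool list" where
  "attach \<phi> s = (if s = [] then [] else \<phi> (butlast s) @ [last s])"

definition attach_level :: "nat \<Rightarrow> (bool list \<Rightarrow> bool list) \<Rightarrow> nat" where
  "attach_level k \<phi> = length (attach \<phi> (replicate k True))"

lemma attach_prefix: "strong_emb \<phi> \<Longrightarrow> prefix (attach \<phi> s) (\<phi> s)"
  using strong_emb_step[of \<phi> "butlast s" "last s"] by (cases "s = []") (simp_all add: attach_def)

lemma length_attach:
  assumes "strong_emb \<phi>" "length s = k"
  shows "length (attach \<phi> s) = attach_level k \<phi>"
proof -
  have "length (\<phi> (butlast s)) = length (\<phi> (butlast (replicate k True)))"
    using assms(2) by (intro strong_emb_length[OF assms(1)]) simp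
  then show ?thesis using assms(2) by (auto simp: attach_level_def attach_def)
qed

lemma attach_inj:
  assumes "strong_emb \<phi>" "length s = length t" "attach \<phi> s = attach \<phi> t"
  shows "s = t"
proof (cases "s = []")
  case False
  have "t \<noteq> []" using False assms(2) by (metis length_0_conv)
  with False assms(3) have eq: "\<phi> (butlast s) @ [last s] = \<phi> (butlast t) @ [last t]"
    unfolding attach_def by (simp only: if_False)
  have "butlast s = butlast t"
    by (rule strong_emb_inj[OF assms(1)]) (use eq assms(2) in simp_all)
  then show ?thesis using False \<open>t \<noteq> []\<close> eq by (metis append_butlast_last_id last_snoc)
next
  case True
  then show ?thesis using assms(2) by (metis length_0_conv)
qed

lemma length_less_attach_level:
  assumes "strong_emb \<phi>" "length s < k"
  shows "length (\<phi> s) < attach_level k \<phi>"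
proof -
  obtain j where k: "k = Suc j" using assms by (cases k) auto
  have "attach_level k \<phi> = Suc (length (\<phi> (replicate j True)))"
    unfolding attach_level_def attach_def k by (simp add: replicate_append_same[symmetric])
  moreover have "length (\<phi> s) \<le> length (\<phi> (replicate j True))"
  proof (cases "length s = j")
    case True
    then show ?thesis using strong_emb_length[OF assms(1), of s "replicate j True"] by simp
  next
    case False
    then show ?thesis using strong_emb_length_mono[OF assms(1), of s "replicate j True"] assms k by simp
  qed
  ultimately show ?thesis by simp
qed

lemma trunc_attach:
  assumes "trunc k \<phi> = trunc k \<phi>'" "length s = k"
  shows "attach \<phi> s = attach \<phi>' s"
proof (cases "s = []")
  case False
  then have "length (butlast s) < k" using assms(2) by (cases s) auto
  then have "\<phi> (butlast s) = \<phi>' (butlast s)" using fun_cong[OF assms(1), of "butlast s"] by (simp add: trunc_def)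
  then show ?thesis by (simp add: attach_def)
qed (simp add: attach_def)

lemma trunc_attach_level: "trunc k \<phi> = trunc k \<phi>' \<Longrightarrow> attach_level k \<phi> = attach_level k \<phi>'"
  using trunc_attach[of k \<phi> \<phi>' "replicate k True"] by (simp add: attach_level_def)

lemma trunc_comp_low:
  assumes "strong_emb \<phi>" "\<And>s. length s < attach_level k \<phi> \<Longrightarrow> \<theta> s = s"
  shows "trunc k (\<theta> \<circ> \<phi>) = trunc k \<phi>"
  using assms length_less_attach_level by (auto simp: trunc_def fun_eq_iff)

lemma trunc_comp_trunc: "trunc k (\<theta> \<circ> trunc k \<phi>) = trunc k (\<theta> \<circ> \<phi>)"
  by (auto simp: trunc_def fun_eq_iff)

text \<open>Nodes on the levels below \<open>k\<close> are shorter than \<open>N\<close>, which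
  leaves finitely many values. The fusion can therefore deal with all restrictions of one attaching
  level in one stage.\<close>

lemma finite_attach_level: "finite {trunc k \<phi> |\<phi>. strong_emb \<phi> \<and> attach_level k \<phi> = N}"
proof -
  have "finite {t :: bool list. length t \<le> N}" for N
    using finite_lists_length_le[OF finite[of "UNIV :: bool set"], of N] by simp
  then have "finite ({f. \<forall>s. (s \<in> {s. length s \<le> k} \<longrightarrow> f s \<in> {t. length t \<le> N}) \<and> (s \<notin> {s. length s \<le> k} \<longrightarrow> f s = [])}
    :: (bool list \<Rightarrow> bool list) set)"
    by (intro finite_set_of_finite_funs)
  moreover have "{trunc k \<phi> |\<phi>. strong_emb \<phi> \<and> attach_level k \<phi> = N} \<subseteq>
    {f. \<forall>s. (s \<in> {s. length s \<le> k} \<longrightarrow> f s \<in> {t. length t \<le> N}) \<and> (s \<notin> {s. length s \<le> k} \<longrightarrow> f s = [])}"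
  proof (clarify, intro conjI impI)
    fix \<phi> s
    assume \<phi>: "strong_emb \<phi>" "N = attach_level k \<phi>"
    show "trunc k \<phi> s \<in> {t. length t \<le> attach_level k \<phi>}"
      using length_less_attach_level[OF \<phi>(1), of s k] by (cases "length s < k") (simp_all add: trunc_def)
    show "trunc k \<phi> s = []" if "s \<notin> {s. length s \<le> k}"
      using that by (simp add: trunc_def)
  qed
  ultimately show ?thesis by (rule rev_finite_subset)
qed

text \<open>The Halpern--Laeuchli step: a word over the alphabet of functions from the nodes of level \<open>N\<close>
  to \<open>bool\<close> is a simultaneous choice of a node of the same level above every node of level \<open>N\<close>.\<close>

lemma homogenize_one:
  fixes c :: "(bool list \<Rightarrow> bool list) \<Rightarrow> 'c"
  assumes \<phi>0: "strong_emb \<phi>0" and c: "finite (range c)"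
  shows "\<exists>\<theta> col. strong_emb \<theta> \<and> (\<forall>s. length s < attach_level k \<phi>0 \<longrightarrow> \<theta> s = s) \<and>
    (\<forall>\<phi>. strong_emb \<phi> \<longrightarrow> trunc k \<phi> = trunc k \<phi>0 \<longrightarrow> c (trunc (Suc k) (\<theta> \<circ> \<phi>)) = col)"
proof -
  define N where "N = attach_level k \<phi>0"
  define A where "A = {f :: bool list \<Rightarrow> bool. \<forall>r. (r \<in> {r. length r = N} \<longrightarrow> f r \<in> UNIV) \<and> (r \<notin> {r. length r = N} \<longrightarrow> f r = False)}"
  have "finite {r :: bool list. length r = N}"
    using finite_lists_length_eq[OF finite[of "UNIV :: bool set"], of N] by simp
  then have A: "finite A" unfolding A_def by (intro finite_set_of_finite_funs) simp_all
  \<comment> \<open>The restriction to k + 1 levels encoded by the word \<open>u\<close>: above each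
    attaching node stand the bits that the letters of \<open>u\<close> have at that node.\<close>
  define place where "place u = (\<lambda>s. if length s < k then \<phi>0 s else if length s = k
    then attach \<phi>0 s @ map (\<lambda>f. f (attach \<phi>0 s)) u else [])" for u :: "(bool list \<Rightarrow> bool) list"
  have fin: "finite (range (c \<circ> place))" using c by (rule rev_finite_subset) auto
  obtain w0 w col where w: "\<And>i. \<exists>v. w i = None # v"
    and col: "\<And>as. set as \<subseteq> A \<Longrightarrow> (c \<circ> place) (w0 @ subst_all w as) = col"
    using Carlson_Simpson[OF A fin] by metis
  \<comment> \<open>The bits of \<open>t\<close> enter as constant letters. This is harmless
    although these need not lie in \<open>A\<close>: by \<open>subst_proj\<close>, reading at
    \<open>r\<close> depends only on the values of the letters at \<open>r\<close>.\<close>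
  define proj where "proj r t = map (\<lambda>f. f r) (w0 @ subst_all w (map (\<lambda>b _. b) t))" for r :: "bool list" and t :: "bool list"
  define \<theta> where "\<theta> s = (if length s < N then s else take N s @ proj (take N s) (drop N s))" for s
  \<comment> \<open>Here left variable words are needed: the next \<open>w i\<close> begins with the
    variable, so the bit \<open>a\<close> follows immediately.\<close>
  have proj_snoc: "prefix (proj r t @ [a]) (proj r (t @ [a]))" for r t a
    using w[of "length t"] by (auto simp: proj_def subst_all_snoc subst_def)
  have len_proj: "length (proj r t) = length w0 + (\<Sum>i<length t. length (w i))" for r t
    by (simp add: proj_def length_subst_all)
  have emb: "strong_emb \<theta>"
    unfolding strong_emb_def
  proof (intro conjI allI impI)
    show "length (\<theta> s) = length (\<theta> t)" if "length s = length t" for s t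
      using that by (simp add: \<theta>_def len_proj)
    show "prefix (\<theta> s @ [a]) (\<theta> (s @ [a]))" for s a
    proof -
      consider "Suc (length s) < N" | "Suc (length s) = N" | "N \<le> length s" by linarith
      then show ?thesis
        by cases (use proj_snoc in \<open>auto simp: \<theta>_def\<close>)
    qed
  qed
  have "c (trunc (Suc k) (\<theta> \<circ> \<phi>)) = col" if \<phi>: "strong_emb \<phi>" "trunc k \<phi> = trunc k \<phi>0" for \<phi>
  proof -
    define m where "m = length (\<phi> (replicate k True)) - N"
    have N: "N = attach_level k \<phi>" using trunc_attach_level[OF \<phi>(2)] by (simp add: N_def)
    \<comment> \<open>The bits of \<phi> above level \<open>N\<close>, one position at a time. Nodes
      of level \<open>N\<close> that are not attaching nodes get False.\<close>
    define letter where "letter j = (\<lambda>r. length r = N \<and> (\<exists>s. length s = k \<and> attach \<phi> s = r \<and> \<phi> s ! (N + j)))" for j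
    define as where "as = map letter [0..<m]"
    have "set as \<subseteq> A" by (auto simp: as_def A_def letter_def)
    have node: "take N (\<phi> s) = attach \<phi> s" "length (\<phi> s) = N + m" if s: "length s = k" for s
    proof -
      show 1: "take N (\<phi> s) = attach \<phi> s"
        using attach_prefix[OF \<phi>(1), of s] length_attach[OF \<phi>(1) s] N by (metis append_eq_conv_conj prefix_def)
      have "N \<le> length (\<phi> s)" using length_attach[OF \<phi>(1) s] N 1 prefix_length_le[OF attach_prefix[OF \<phi>(1), of s]] by simp
      moreover have "length (\<phi> s) = length (\<phi> (replicate k True))" using s by (intro strong_emb_length[OF \<phi>(1)]) simp
      ultimately show "length (\<phi> s) = N + m" by (simp add: m_def)
    qed
    have letters: "letter j (attach \<phi> s) = \<phi> s ! (N + j)" if s: "length s = k" for s j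
      using attach_inj[OF \<phi>(1)] s length_attach[OF \<phi>(1) s] N by (auto simp: letter_def)
    have subst_proj: "map (\<lambda>f. f r) (subst_all v (map (\<lambda>b _. b) (map (\<lambda>f. f r) fs))) = map (\<lambda>f. f r) (subst_all v fs)"
      for r :: "bool list" and v and fs :: "(bool list \<Rightarrow> bool) list"
      by (induction fs arbitrary: v) (auto simp: subst_def split: option.splits)
    have "\<theta> (\<phi> s) = attach \<phi>0 s @ map (\<lambda>f. f (attach \<phi>0 s)) (w0 @ subst_all w as)" if s: "length s = k" for s
    proof -
      have "drop N (\<phi> s) = map (\<lambda>f. f (attach \<phi> s)) as"
        by (rule nth_equalityI) (use node[OF s] letters[OF s] in \<open>auto simp: as_def\<close>)
      then have "\<theta> (\<phi> s) = attach \<phi> s @ map (\<lambda>f. f (attach \<phi> s)) (w0 @ subst_all w as)"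
        using node[OF s] by (simp add: \<theta>_def proj_def subst_proj del: map_map)
      then show ?thesis using trunc_attach[OF \<phi>(2) s] by simp
    qed
    moreover have "\<theta> (\<phi> s) = \<phi>0 s" if s: "length s < k" for s
      using length_less_attach_level[OF \<phi>(1) s] N fun_cong[OF \<phi>(2), of s] s by (simp add: \<theta>_def trunc_def)
    ultimately have "trunc (Suc k) (\<theta> \<circ> \<phi>) = place (w0 @ subst_all w as)"
      by (auto simp: trunc_def place_def fun_eq_iff)
    then show ?thesis using col[OF \<open>set as \<subseteq> A\<close>] by simp
  qed
  then show ?thesis using emb by (intro exI[of _ \<theta>] exI[of _ col]) (simp add: \<theta>_def N_def)
qed

text \<open>Restrictions are treated one after another. A later \<theta> is the identity below
  \<open>N\<close>, so composing with it preserves the restriction to \<open>k\<close> levels and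
  with it the constancy achieved before.\<close>

lemma homogenize_finite:
  fixes c :: "(bool list \<Rightarrow> bool list) \<Rightarrow> 'c"
  assumes c: "finite (range c)" and S: "finite S" "S \<subseteq> {trunc k \<phi> |\<phi>. strong_emb \<phi> \<and> attach_level k \<phi> = N}"
  shows "\<exists>\<theta>. strong_emb \<theta> \<and> (\<forall>s. length s < N \<longrightarrow> \<theta> s = s) \<and>
    (\<forall>\<sigma>\<in>S. \<exists>col. \<forall>\<phi>. strong_emb \<phi> \<longrightarrow> trunc k \<phi> = \<sigma> \<longrightarrow> c (trunc (Suc k) (\<theta> \<circ> \<phi>)) = col)"
  using S
proof (induction S rule: finite_induct)
  case empty
  show ?case using strong_emb_id by (intro exI[of _ "\<lambda>s. s"]) simp
next
  case (insert \<sigma> S)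
  then have "S \<subseteq> {trunc k \<phi> |\<phi>. strong_emb \<phi> \<and> attach_level k \<phi> = N}" by blast
  from insert.IH[OF this] obtain \<theta>1 where \<theta>1: "strong_emb \<theta>1" "\<And>s. length s < N \<Longrightarrow> \<theta>1 s = s"
    "\<And>\<sigma>. \<sigma> \<in> S \<Longrightarrow> \<exists>col. \<forall>\<phi>. strong_emb \<phi> \<longrightarrow> trunc k \<phi> = \<sigma> \<longrightarrow> c (trunc (Suc k) (\<theta>1 \<circ> \<phi>)) = col"
    by blast
  from insert.prems obtain \<phi>0 where \<phi>0: "strong_emb \<phi>0" "attach_level k \<phi>0 = N" "\<sigma> = trunc k \<phi>0" by auto
  define c' where "c' \<zeta> = c (trunc (Suc k) (\<theta>1 \<circ> \<zeta>))" for \<zeta>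
  have "finite (range c')" using c by (rule rev_finite_subset) (auto simp: c'_def)
  from homogenize_one[OF \<phi>0(1) this, of k] obtain \<theta>2 col where \<theta>2: "strong_emb \<theta>2"
    "\<And>s. length s < N \<Longrightarrow> \<theta>2 s = s"
    "\<And>\<phi>. strong_emb \<phi> \<Longrightarrow> trunc k \<phi> = \<sigma> \<Longrightarrow> c' (trunc (Suc k) (\<theta>2 \<circ> \<phi>)) = col"
    using \<phi>0 by auto
  have "\<exists>col. \<forall>\<phi>. strong_emb \<phi> \<longrightarrow> trunc k \<phi> = \<tau> \<longrightarrow> c (trunc (Suc k) (\<theta>1 \<circ> \<theta>2 \<circ> \<phi>)) = col"
    if \<tau>: "\<tau> \<in> insert \<sigma> S" for \<tau>
  proof (cases "\<tau> = \<sigma>")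
    case True
    then show ?thesis using \<theta>2(3) by (auto simp: c'_def trunc_comp_trunc comp_assoc)
  next
    case False
    with \<tau> obtain col where col: "\<And>\<phi>. strong_emb \<phi> \<Longrightarrow> trunc k \<phi> = \<tau> \<Longrightarrow> c (trunc (Suc k) (\<theta>1 \<circ> \<phi>)) = col"
      using \<theta>1(3)[of \<tau>] by auto
    have "c (trunc (Suc k) (\<theta>1 \<circ> (\<theta>2 \<circ> \<phi>))) = col" if \<phi>: "strong_emb \<phi>" "trunc k \<phi> = \<tau>" for \<phi>
    proof (rule col)
      show "strong_emb (\<theta>2 \<circ> \<phi>)" using \<theta>2(1) \<phi>(1) by (rule strong_emb_comp)
      from \<tau> insert.prems obtain \<phi>' where "strong_emb \<phi>'" "attach_level k \<phi>' = N" "\<tau> = trunc k \<phi>'" by auto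
      then have "attach_level k \<phi> = N" using trunc_attach_level[of k \<phi> \<phi>'] \<phi> by simp
      then show "trunc k (\<theta>2 \<circ> \<phi>) = \<tau>" using trunc_comp_low[OF \<phi>(1), of k \<theta>2] \<theta>2(2) \<phi>(2) by simp
    qed
    then show ?thesis by (auto simp: comp_assoc)
  qed
  moreover have "(\<theta>1 \<circ> \<theta>2) s = s" if "length s < N" for s using \<theta>1(2) \<theta>2(2) that by simp
  ultimately show ?case using strong_emb_comp[OF \<theta>1(1) \<theta>2(1)] by blast
qed

text \<open>Fusion: stage \<open>N\<close> settles the restrictions with attaching level
  \<open>N\<close> and fixes all nodes below level \<open>N\<close>. The compositions therefore
  stabilise on every node, and the later stages act on an extension without changing its
  restriction.\<close>

lemma homogenize_level:
  fixes c :: "(bool list \<Rightarrow> bool list) \<Rightarrow> 'c"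
  assumes c: "finite (range c)"
  shows "\<exists>\<psi>. strong_emb \<psi> \<and> (\<forall>\<phi> \<phi>'. strong_emb \<phi> \<longrightarrow> strong_emb \<phi>' \<longrightarrow> trunc k \<phi> = trunc k \<phi>' \<longrightarrow>
    c (trunc (Suc k) (\<psi> \<circ> \<phi>)) = c (trunc (Suc k) (\<psi> \<circ> \<phi>')))"
proof -
  let ?good = "\<lambda>N c \<theta>. strong_emb \<theta> \<and> (\<forall>s. length s < N \<longrightarrow> \<theta> s = s) \<and>
    (\<forall>\<sigma>\<in>{trunc k \<phi> |\<phi>. strong_emb \<phi> \<and> attach_level k \<phi> = N}.
      \<exists>col. \<forall>\<phi>. strong_emb \<phi> \<longrightarrow> trunc k \<phi> = \<sigma> \<longrightarrow> c (trunc (Suc k) (\<theta> \<circ> \<phi>)) = col)"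
  define pull where "pull \<psi> \<zeta> = c (trunc (Suc k) (\<psi> \<circ> \<zeta>))" for \<psi> \<zeta> :: "bool list \<Rightarrow> bool list"
  define pick where "pick N \<psi> = (SOME \<theta>. ?good N (pull \<psi>) \<theta>)" for N \<psi>
  have pick: "?good N (pull \<psi>) (pick N \<psi>)" for N \<psi>
  proof -
    have "finite (range (pull \<psi>))" using c by (rule rev_finite_subset) (auto simp: pull_def)
    from homogenize_finite[OF this finite_attach_level subset_refl, of N k]
    show ?thesis unfolding pick_def by (rule someI_ex)
  qed
  define \<Psi> where "\<Psi> = rec_nat (\<lambda>s. s) (\<lambda>N \<psi>. \<psi> \<circ> pick N \<psi>)"
  have \<Psi>_0: "\<Psi> 0 = (\<lambda>s. s)" and \<Psi>_Suc: "\<Psi> (Suc N) = \<Psi> N \<circ> pick N (\<Psi> N)" for N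
    by (simp_all add: \<Psi>_def)
  have pick_emb: "strong_emb (pick N \<psi>)" and pick_low: "length s < N \<Longrightarrow> pick N \<psi> s = s" for N \<psi> s
    using pick[of N \<psi>] by simp_all
  have \<Psi>_emb: "strong_emb (\<Psi> N)" for N
    by (induction N) (simp_all only: \<Psi>_0 \<Psi>_Suc strong_emb_id strong_emb_comp pick_emb)
  have factor: "\<exists>\<eta>. strong_emb \<eta> \<and> (\<forall>s. length s < N \<longrightarrow> \<eta> s = s) \<and> \<Psi> (N + d) = \<Psi> N \<circ> \<eta>" for N d
  proof (induction d)
    case 0
    show ?case using strong_emb_id by (intro exI[of _ "\<lambda>s. s"]) (simp add: fun_eq_iff)
  next
    case (Suc d)
    then obtain \<eta> where "strong_emb \<eta>" "\<forall>s. length s < N \<longrightarrow> \<eta> s = s" "\<Psi> (N + d) = \<Psi> N \<circ> \<eta>" by blast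
    moreover from this have "\<Psi> (N + Suc d) = \<Psi> N \<circ> (\<eta> \<circ> pick (N + d) (\<Psi> (N + d)))"
      by (simp add: \<Psi>_Suc comp_assoc)
    moreover have "(\<eta> \<circ> pick (N + d) (\<Psi> (N + d))) s = s" if "length s < N" for s
      using calculation that pick_low[of s "N + d"] by simp
    ultimately show ?case using strong_emb_comp[OF _ pick_emb] by blast
  qed
  define \<psi> where "\<psi> s = \<Psi> (Suc (length s)) s" for s
  have \<psi>: "\<psi> s = \<Psi> M s" if M: "length s < M" for s M
  proof -
    obtain d where "M = Suc (length s) + d" using M less_iff_Suc_add by auto
    moreover obtain \<eta> where "\<forall>t. length t < Suc (length s) \<longrightarrow> \<eta> t = t" "\<Psi> (Suc (length s) + d) = \<Psi> (Suc (length s)) \<circ> \<eta>"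
      using factor by blast
    ultimately show ?thesis by (simp add: \<psi>_def)
  qed
  have "strong_emb \<psi>"
    unfolding strong_emb_def
  proof (intro conjI allI impI)
    show "length (\<psi> s) = length (\<psi> t)" if "length s = length t" for s t
      using strong_emb_length[OF \<Psi>_emb that, of "Suc (length s)"] that by (simp add: \<psi>_def)
    show "prefix (\<psi> s @ [a]) (\<psi> (s @ [a]))" for s a
      using strong_emb_step[OF \<Psi>_emb[of "Suc (Suc (length s))"]] \<psi>[of s "Suc (Suc (length s))"]
        \<psi>[of "s @ [a]" "Suc (Suc (length s))"]
      by simp
  qed
  moreover have "c (trunc (Suc k) (\<psi> \<circ> \<phi>)) = c (trunc (Suc k) (\<psi> \<circ> \<phi>'))"
    if \<phi>: "strong_emb \<phi>" "strong_emb \<phi>'" "trunc k \<phi> = trunc k \<phi>'" for \<phi> \<phi>'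
  proof -
    define N where "N = attach_level k \<phi>"
    have N': "attach_level k \<phi>' = N" using trunc_attach_level[OF \<phi>(3)] by (simp add: N_def)
    obtain col where col: "\<And>\<xi>. strong_emb \<xi> \<Longrightarrow> trunc k \<xi> = trunc k \<phi> \<Longrightarrow>
      pull (\<Psi> N) (trunc (Suc k) (pick N (\<Psi> N) \<circ> \<xi>)) = col"
      using pick[of N "\<Psi> N"] \<phi>(1) N_def by blast
    have "c (trunc (Suc k) (\<psi> \<circ> \<xi>)) = col"
      if \<xi>: "strong_emb \<xi>" "trunc k \<xi> = trunc k \<phi>" for \<xi>
    proof -
      have level: "attach_level k \<xi> = N" using trunc_attach_level[OF \<xi>(2)] by (simp add: N_def)
      \<comment> \<open>Large enough that the stage \<open>Suc N + d\<close> already equals \<psi>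
        on all nodes of \<xi> up to level \<open>k\<close>.\<close>
      define d where "d = Suc (length (\<xi> (replicate (Suc k) True)))"
      obtain \<eta> where \<eta>: "strong_emb \<eta>" "\<And>s. length s < Suc N \<Longrightarrow> \<eta> s = s" "\<Psi> (Suc N + d) = \<Psi> (Suc N) \<circ> \<eta>"
        using factor by blast
      have "length (\<xi> s) < Suc N + d" if "length s < Suc k" for s
        using strong_emb_length_mono[OF \<xi>(1), of s "replicate (Suc k) True"] that by (simp add: d_def)
      then have "trunc (Suc k) (\<psi> \<circ> \<xi>) = trunc (Suc k) (\<Psi> (Suc N + d) \<circ> \<xi>)"
        using \<psi> by (auto simp: trunc_def fun_eq_iff)
      also have "\<dots> = trunc (Suc k) (\<Psi> N \<circ> (pick N (\<Psi> N) \<circ> (\<eta> \<circ> \<xi>)))"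
        unfolding \<eta>(3) \<Psi>_Suc by (simp add: comp_assoc)
      finally have "c (trunc (Suc k) (\<psi> \<circ> \<xi>)) = pull (\<Psi> N) (trunc (Suc k) (pick N (\<Psi> N) \<circ> (\<eta> \<circ> \<xi>)))"
        by (simp add: pull_def trunc_comp_trunc)
      also have "\<dots> = col"
      proof (rule col)
        show "strong_emb (\<eta> \<circ> \<xi>)" using \<eta>(1) \<xi>(1) by (rule strong_emb_comp)
        show "trunc k (\<eta> \<circ> \<xi>) = trunc k \<phi>"
          using trunc_comp_low[OF \<xi>(1), of k \<eta>] \<eta>(2) level \<xi>(2) by simp
      qed
      finally show ?thesis .
    qed
    then show ?thesis using \<phi> by simp
  qed
  ultimately show ?thesis by blast
qed

theorem Milliken:
  fixes c :: "(bool list \<Rightarrow> bool list) \<Rightarrow> 'c"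
  assumes "finite (range c)"
  shows "\<exists>\<psi> col. strong_emb \<psi> \<and> (\<forall>\<phi>. strong_emb \<phi> \<longrightarrow> c (trunc k (\<psi> \<circ> \<phi>)) = col)"
  using assms
proof (induction k arbitrary: c)
  case 0
  have "trunc 0 \<phi> = (\<lambda>_. [])" for \<phi> by (simp add: trunc_def fun_eq_iff)
  then show ?case using strong_emb_id by auto
next
  case (Suc k)
  from homogenize_level[OF Suc.prems, of k] obtain \<psi>1 where \<psi>1: "strong_emb \<psi>1"
    "\<And>\<phi> \<phi>'. strong_emb \<phi> \<Longrightarrow> strong_emb \<phi>' \<Longrightarrow> trunc k \<phi> = trunc k \<phi>' \<Longrightarrow>
      c (trunc (Suc k) (\<psi>1 \<circ> \<phi>)) = c (trunc (Suc k) (\<psi>1 \<circ> \<phi>'))"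
    by blast
  \<comment> \<open>By the choice of \<psi>1 the colour is the same for all extensions of a
    restriction \<zeta>, so it does not matter which one is selected.\<close>
  define c' where "c' \<zeta> = c (trunc (Suc k) (\<psi>1 \<circ> (SOME \<phi>. strong_emb \<phi> \<and> trunc k \<phi> = \<zeta>)))" for \<zeta>
  have c': "c' (trunc k \<phi>) = c (trunc (Suc k) (\<psi>1 \<circ> \<phi>))" if "strong_emb \<phi>" for \<phi>
    unfolding c'_def
  proof (rule someI2[where P = "\<lambda>\<xi>. strong_emb \<xi> \<and> trunc k \<xi> = trunc k \<phi>"])
    show "strong_emb \<phi> \<and> trunc k \<phi> = trunc k \<phi>" using that by simp
  qed (use \<psi>1(2) that in blast)
  have "finite (range c')" using Suc.prems by (rule rev_finite_subset) (auto simp: c'_def)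
  from Suc.IH[OF this] obtain \<psi>2 col where \<psi>2: "strong_emb \<psi>2"
    "\<And>\<phi>. strong_emb \<phi> \<Longrightarrow> c' (trunc k (\<psi>2 \<circ> \<phi>)) = col"
    by blast
  have "c (trunc (Suc k) (\<psi>1 \<circ> \<psi>2 \<circ> \<phi>)) = col" if "strong_emb \<phi>" for \<phi>
    using c'[OF strong_emb_comp[OF \<psi>2(1) that]] \<psi>2(2)[OF that] by (simp add: comp_assoc)
  then show ?case using strong_emb_comp[OF \<psi>1(1) \<psi>2(1)] by blast
qed

section \<open>Tangent numbers\<close>

text \<open>The derivatives of tan at 0, by the Leibniz rule for tan' = 1 + tan^2. The summand 1
  contributes to the first derivative only, whence the separate case m = 0.\<close>

fun tan_num :: "nat \<Rightarrow> nat" where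
  "tan_num 0 = 0"
| "tan_num (Suc m) = (if m = 0 then 1 else \<Sum>i\<le>m. (m choose i) * (tan_num i * tan_num (m - i)))"

text \<open>Differentiating a polynomial in \<open>tan x\<close>, as \<open>tan' = 1 + tan\<^sup>2\<close>.\<close>

definition tan_deriv :: "real poly \<Rightarrow> real poly" where
  "tan_deriv p = pderiv p * [:1, 0, 1:]"

lemma tan_deriv_add: "tan_deriv (p + q) = tan_deriv p + tan_deriv q"
  by (simp add: tan_deriv_def pderiv_add algebra_simps)

lemma tan_deriv_mult: "tan_deriv (p * q) = tan_deriv p * q + p * tan_deriv q"
  by (simp only: tan_deriv_def pderiv_mult algebra_simps)

lemma tan_deriv_sum: "tan_deriv (sum f A) = (\<Sum>i\<in>A. tan_deriv (f i))"
  by (induction A rule: infinite_finite_induct) (simp_all add: tan_deriv_add, simp_all add: tan_deriv_def)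

lemma tan_deriv_of_nat_mult: "tan_deriv (of_nat n * p) = of_nat n * tan_deriv p"
  by (simp add: tan_deriv_mult) (simp add: tan_deriv_def)

lemma tan_deriv_Leibniz:
  "(tan_deriv ^^ m) (p * q) = (\<Sum>i\<le>m. of_nat (m choose i) * ((tan_deriv ^^ i) p * (tan_deriv ^^ (m - i)) q))"
proof (induction m)
  case (Suc m)
  define u where "u i = (tan_deriv ^^ i) p" for i
  define v where "v i = (tan_deriv ^^ i) q" for i
  have uv: "tan_deriv (u i) = u (Suc i)" "tan_deriv (v i) = v (Suc i)" for i
    by (simp_all add: u_def v_def)
  have product: "tan_deriv (of_nat n * (u i * v j)) = of_nat n * (u (Suc i) * v j) + of_nat n * (u i * v (Suc j))"
    for n i j
    by (simp only: tan_deriv_of_nat_mult tan_deriv_mult[of "u i"] uv distrib_left)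
  have "(tan_deriv ^^ Suc m) (p * q) = tan_deriv (\<Sum>i\<le>m. of_nat (m choose i) * (u i * v (m - i)))"
    by (simp add: Suc u_def v_def)
  also have "\<dots> = (\<Sum>i\<le>m. of_nat (m choose i) * (u (Suc i) * v (m - i))) +
      (\<Sum>i\<le>m. of_nat (m choose i) * (u i * v (Suc (m - i))))"
    by (simp only: tan_deriv_sum product sum.distrib)
  also have "(\<Sum>i\<le>m. of_nat (m choose i) * (u i * v (Suc (m - i)))) =
      (\<Sum>i\<le>m. of_nat (m choose i) * (u i * v (Suc m - i)))"
    by (intro sum.cong) (auto simp: Suc_diff_le)
  also have "\<dots> = (\<Sum>i\<le>Suc m. of_nat (m choose i) * (u i * v (Suc m - i)))"
    by simp
  also have "\<dots> = u 0 * v (Suc m) + (\<Sum>i\<le>m. of_nat (m choose Suc i) * (u (Suc i) * v (m - i)))"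
    by (subst sum.atMost_Suc_shift) simp
  also have "(\<Sum>i\<le>m. of_nat (m choose i) * (u (Suc i) * v (m - i))) + \<dots> =
      (\<Sum>i\<le>Suc m. of_nat (Suc m choose i) * (u i * v (Suc m - i)))"
    by (subst sum.atMost_Suc_shift) (simp add: sum.distrib algebra_simps)
  finally show ?case by (simp add: u_def v_def)
qed simp

lemma deriv_tan: "cos x \<noteq> 0 \<Longrightarrow> (deriv ^^ m) tan x = poly ((tan_deriv ^^ m) [:0, 1:]) (tan x)" for x :: real
proof (induction m arbitrary: x)
  case (Suc m)
  define p where "p = (tan_deriv ^^ m) [:0, 1:]"
  have "((\<lambda>x. poly p (tan x)) has_field_derivative poly (pderiv p) (tan x) * inverse ((cos x)\<^sup>2)) (at x)"
    using DERIV_chain2[OF poly_DERIV DERIV_tan[OF Suc.prems]] by simp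
  moreover have "inverse ((cos x)\<^sup>2) = 1 + (tan x)\<^sup>2"
    using tan_sec[OF Suc.prems] by (simp add: power_inverse)
  moreover have "poly [:1, 0, 1:] y = 1 + y\<^sup>2" for y :: real by (simp add: power2_eq_square)
  ultimately have "((\<lambda>x. poly p (tan x)) has_field_derivative poly (tan_deriv p) (tan x)) (at x)"
    unfolding tan_deriv_def poly_mult by metis
  \<comment> \<open>The formula for the m-th derivative is needed in a neighbourhood of
    \<open>x\<close> before it can be differentiated at \<open>x\<close>.\<close>
  moreover have "open {x :: real. cos x \<noteq> 0}"
    by (intro open_Collect_neq continuous_intros)
  ultimately have "((deriv ^^ m) tan has_field_derivative poly (tan_deriv p) (tan x)) (at x)"
    by (rule has_field_derivative_transform_within_open) (use Suc in \<open>auto simp: p_def\<close>)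
  then show ?case by (simp add: p_def DERIV_imp_deriv)
qed simp

lemma deriv_tan_0: "(deriv ^^ m) tan (0::real) = real (tan_num m)"
proof -
  define a where "a m = poly ((tan_deriv ^^ m) [:0, 1:]) 0" for m
  have a_Suc: "a (Suc m) = (\<Sum>i\<le>m. of_nat (m choose i) * (a i * a (m - i)))" if "m \<noteq> 0" for m
  proof -
    have "\<exists>j. m = Suc j" using that by (rule not0_implies_Suc)
    then obtain j where j: "m = Suc j" by blast
    have const: "(tan_deriv ^^ i) 0 = 0" for i
      by (induction i) (simp_all add: tan_deriv_def)
    have "(tan_deriv ^^ m) (p + q) = (tan_deriv ^^ m) p + (tan_deriv ^^ m) q" for p q
      by (induction m) (simp_all add: tan_deriv_add)
    moreover have "tan_deriv [:0, 1:] = [:1:] + [:0, 1:] * [:0, 1:]"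
      by (simp add: tan_deriv_def pderiv_pCons)
    moreover have "(tan_deriv ^^ m) [:1:] = 0"
      unfolding j funpow_Suc_right comp_apply by (simp add: tan_deriv_def const)
    ultimately have "(tan_deriv ^^ Suc m) [:0, 1:] = (tan_deriv ^^ m) ([:0, 1:] * [:0, 1:])"
      by (simp only: funpow_Suc_right comp_apply add_0_left)
    then show ?thesis
      unfolding a_def by (simp only: tan_deriv_Leibniz poly_sum poly_mult poly_of_nat)
  qed
  have "a m = real (tan_num m)"
  proof (induction m rule: less_induct)
    case (less m)
    show ?case
    proof (cases m)
      case 0
      then show ?thesis by (simp add: a_def)
    next
      case (Suc j)
      show ?thesis
      proof (cases "j = 0")
        case True
        then show ?thesis using Suc by (simp add: a_def tan_deriv_def pderiv_pCons)
      next
        case False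
        have "a m = (\<Sum>i\<le>j. of_nat (j choose i) * (real (tan_num i) * real (tan_num (j - i))))"
          unfolding Suc a_Suc[OF False] by (intro sum.cong) (simp_all add: less Suc)
        then show ?thesis using Suc False by simp
      qed
    qed
  qed
  then show ?thesis using deriv_tan[of 0 m] by (simp add: a_def)
qed

section \<open>Devlin's theorem\<close>

text \<open>The type of a set of words records the tree of its meets together with the order of all levels.\<close>

datatype 'a ltree = Leaf 'a | Node 'a "'a ltree" "'a ltree"

text \<open>Leaves will stand for words and inner nodes for meets, labelled by the ranks of their
  lengths; disjointness of label sets says that no two lengths coincide.\<close>

inductive increasing_tree :: "nat ltree \<Rightarrow> nat set \<Rightarrow> bool" where
  Leaf: "increasing_tree (Leaf l) {l}"
| Node: "increasing_tree t0 L0 \<Longrightarrow> increasing_tree t1 L1 \<Longrightarrow> L0 \<inter> L1 = {} \<Longrightarrow> (\<And>l. l \<in> L0 \<union> L1 \<Longrightarrow> m < l) \<Longrightarrow>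
    increasing_tree (Node m t0 t1) (insert m (L0 \<union> L1))"

lemma increasing_nonempty: "increasing_tree t L \<Longrightarrow> L \<noteq> {}"
  by (induction rule: increasing_tree.induct) auto

text \<open>The root carries the minimum, and a subset \<open>A\<close> of the remaining labels goes
  to the left subtree. Grouping these subsets by size gives the binomial recursion of
  \<open>tan_num\<close>.\<close>

lemma card_increasing:
  "finite L \<Longrightarrow> finite {t. increasing_tree t L} \<and> card {t. increasing_tree t L} \<le> tan_num (card L)"
proof (induction "card L" arbitrary: L rule: less_induct)
  case less
  show ?case
  proof (cases "card L \<le> 1")
    case True
    then have "L = {} \<or> (\<exists>l. L = {l})" using less.prems card_1_singletonE[of L] by (metis card_eq_0_iff le_less_linear less_one nless_le)
    then show ?thesis
    proof
      assume "L = {}"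
      then have "{t. increasing_tree t L} = {}" using increasing_nonempty by auto
      then show ?thesis by simp
    next
      assume "\<exists>l. L = {l}"
      then obtain l where l: "L = {l}" by blast
      have "t = Leaf l" if "increasing_tree t {l}" for t
        using that
      proof cases
        case (Node t0 L0 t1 L1 m)
        then have "m = l" "L0 \<subseteq> {l}" by auto
        moreover obtain x where "x \<in> L0" using increasing_nonempty[OF Node(3)] by blast
        ultimately show ?thesis using Node(6)[of x] by auto
      qed simp
      then have "{t. increasing_tree t L} = {Leaf l}" using l increasing_tree.Leaf by auto
      then show ?thesis using l by simp
    qed
  next
    case False
    define m where "m = Min L"
    define L' where "L' = L - {m}"
    have L: "L \<noteq> {}" "m \<in> L" using False less.prems by (auto simp: m_def intro!: Min_in)
    have L': "finite L'" "L = insert m L'" "m \<notin> L'" using less.prems L by (auto simp: L'_def)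
    then have card: "card L = Suc (card L')" "card L' \<noteq> 0" using False by auto
    define F where "F A = (\<lambda>(t0, t1). Node m t0 t1) ` ({t. increasing_tree t A} \<times> {t. increasing_tree t (L' - A)})" for A
    have F: "finite (F A) \<and> card (F A) \<le> tan_num (card A) * tan_num (card L' - card A)" if A: "A \<in> Pow L'" for A
    proof -
      have "finite A" using A L'(1) finite_subset by auto
      have "card A < card L" "card (L' - A) < card L"
        using A L' card by (auto simp: less_Suc_eq_le intro!: card_mono)
      then have *: "finite {t. increasing_tree t A} \<and> card {t. increasing_tree t A} \<le> tan_num (card A)"
        "finite {t. increasing_tree t (L' - A)} \<and> card {t. increasing_tree t (L' - A)} \<le> tan_num (card L' - card A)"
        using less.hyps[of A] less.hyps[of "L' - A"] \<open>finite A\<close> L'(1) A by (simp_all add: card_Diff_subset)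
      have "card (F A) \<le> card ({t. increasing_tree t A} \<times> {t. increasing_tree t (L' - A)})"
        unfolding F_def using * by (intro card_image_le) simp
      also have "\<dots> \<le> tan_num (card A) * tan_num (card L' - card A)"
        unfolding card_cartesian_product using * by (intro mult_le_mono) simp_all
      finally show ?thesis using * by (simp add: F_def)
    qed
    have sub: "{t. increasing_tree t L} \<subseteq> (\<Union>A\<in>Pow L'. F A)"
    proof
      fix t assume "t \<in> {t. increasing_tree t L}"
      then have "increasing_tree t L" by simp
      then show "t \<in> (\<Union>A\<in>Pow L'. F A)"
      proof cases
        case (Leaf l)
        then show ?thesis using False by simp
      next
        case (Node t0 L0 t1 L1 m')
        have "m' = m" unfolding m_def Node(2)
          using Node(6) less.prems Node(2) by (intro Min_eqI[symmetric]) (auto simp: less_imp_le)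
        moreover from this have "L' = L0 \<union> L1" using Node(6) by (auto simp: L'_def Node(2))
        moreover from this have "L' - L0 = L1" using Node(5) by auto
        ultimately show ?thesis using Node by (auto simp: F_def intro!: bexI[of _ L0])
      qed
    qed
    have fin: "finite (\<Union>A\<in>Pow L'. F A)" using F L'(1) by blast
    have "card {t. increasing_tree t L} \<le> card (\<Union>A\<in>Pow L'. F A)" using fin sub by (rule card_mono)
    also have "\<dots> \<le> (\<Sum>A\<in>Pow L'. card (F A))" using L'(1) by (intro card_UN_le) simp
    also have "\<dots> \<le> (\<Sum>A\<in>Pow L'. tan_num (card A) * tan_num (card L' - card A))"
      using F by (intro sum_mono) blast
    also have "\<dots> = (\<Sum>i\<le>card L'. \<Sum>A\<in>{A \<in> Pow L'. card A = i}. tan_num (card A) * tan_num (card L' - card A))"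
      using L'(1) by (intro sum.group[symmetric]) (auto intro: card_mono)
    also have "\<dots> = (\<Sum>i\<le>card L'. (card L' choose i) * (tan_num i * tan_num (card L' - i)))"
      using n_subsets[OF L'(1)] by (intro sum.cong) simp_all
    also have "\<dots> = tan_num (card L)" using card by simp
    finally show ?thesis using fin sub finite_subset by blast
  qed
qed

lemma increasing_map:
  assumes "increasing_tree t L" "strict_mono_on L \<rho>"
  shows "increasing_tree (map_ltree \<rho> t) (\<rho> ` L)"
  using assms
proof (induction rule: increasing_tree.induct)
  case (Leaf l)
  show ?case by (simp add: increasing_tree.Leaf)
next
  case (Node t0 L0 t1 L1 m)
  have mono: "strict_mono_on L0 \<rho>" "strict_mono_on L1 \<rho>"
    using Node.prems by (auto simp: strict_mono_on_def)
  have "inj_on \<rho> (insert m (L0 \<union> L1))" using Node.prems by (rule strict_mono_on_imp_inj_on)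
  then have "\<rho> ` L0 \<inter> \<rho> ` L1 = {}" using Node.hyps(3) by (auto simp: inj_on_def)
  moreover have "\<rho> m < l" if "l \<in> \<rho> ` L0 \<union> \<rho> ` L1" for l
    using Node.prems Node.hyps(4) that by (auto simp: strict_mono_on_def)
  ultimately have "increasing_tree (Node (\<rho> m) (map_ltree \<rho> t0) (map_ltree \<rho> t1)) (insert (\<rho> m) (\<rho> ` L0 \<union> \<rho> ` L1))"
    using Node.IH mono by (intro increasing_tree.Node) auto
  then show ?case by (simp add: image_Un)
qed

section \<open>Antichains of words and their trees of meets\<close>

definition left_of :: "bool list \<Rightarrow> bool list \<Rightarrow> bool" where
  "left_of s t \<longleftrightarrow> (\<exists>r. prefix (r @ [False]) s \<and> prefix (r @ [True]) t)"

definition diverging :: "bool list set \<Rightarrow> bool" where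
  "diverging U \<longleftrightarrow> (\<forall>s\<in>U. \<forall>t\<in>U. s \<noteq> t \<longrightarrow> left_of s t \<or> left_of t s)"

inductive splits :: "bool list set \<Rightarrow> bool list ltree \<Rightarrow> bool" where
  Leaf: "splits {u} (Leaf u)"
| Node: "splits U0 t0 \<Longrightarrow> splits U1 t1 \<Longrightarrow> (\<And>u. u \<in> U0 \<Longrightarrow> prefix (r @ [False]) u) \<Longrightarrow>
    (\<And>u. u \<in> U1 \<Longrightarrow> prefix (r @ [True]) u) \<Longrightarrow> splits (U0 \<union> U1) (Node r t0 t1)"

lemma prefix_snoc_unique: "prefix (r @ [a]) u \<Longrightarrow> prefix (r @ [b]) u \<Longrightarrow> a = b"
  by (auto simp: prefix_def)

lemma not_prefix_snoc: "prefix (r @ [True]) u \<Longrightarrow> \<not> prefix (r @ [False]) u" "prefix (r @ [False]) u \<Longrightarrow> \<not> prefix (r @ [True]) u"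
  by (auto simp: prefix_def)

lemma splits_nonempty: "splits U t \<Longrightarrow> U \<noteq> {}"
  by (induction rule: splits.induct) auto

text \<open>The root is the longest common prefix \<open>r\<close>. No member equals
  \<open>r\<close>, since diverging words are not prefixes of one another, and both directions at
  \<open>r\<close> occur by maximality.\<close>

lemma splits_exists: "finite U \<Longrightarrow> U \<noteq> {} \<Longrightarrow> diverging U \<Longrightarrow> \<exists>t. splits U t"
proof (induction "card U" arbitrary: U rule: less_induct)
  case less
  obtain u0 where u0: "u0 \<in> U" using less.prems by blast
  show ?case
  proof (cases "U = {u0}")
    case True
    then show ?thesis using splits.Leaf by blast
  next
    case False
    then obtain v0 where v0: "v0 \<in> U" "v0 \<noteq> u0" using u0 by blast
    define common where "common r \<longleftrightarrow> (\<forall>u\<in>U. prefix r u)" for r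
    have "\<forall>r. common r \<longrightarrow> length r < Suc (length u0)"
      using u0 prefix_length_le by (fastforce simp: common_def)
    moreover have "common []" by (simp add: common_def)
    ultimately obtain r where r: "common r" and max: "\<And>r'. common r' \<Longrightarrow> length r' \<le> length r"
      using ex_has_greatest_nat[of common "[]" length] by blast
    define V where "V a = {u \<in> U. prefix (r @ [a]) u}" for a
    have ext: "\<exists>a. prefix (r @ [a]) u" if u: "u \<in> U" for u
    proof -
      obtain v where v: "v \<in> U" "v \<noteq> u" using u0 v0 by (cases "u = u0") auto
      then obtain q a b where q: "prefix (q @ [a]) u" "prefix (q @ [b]) v" "a \<noteq> b"
      proof -
        have "left_of u v \<or> left_of v u" using less.prems(3) u v unfolding diverging_def by blast
        then show thesis unfolding left_of_def using that[of _ False True] that[of _ True False] by blast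
      qed
      have "prefix r u" "prefix r v" using r u v by (auto simp: common_def)
      have "u \<noteq> r"
      proof
        assume "u = r"
        then have "prefix (q @ [a]) v" using q(1) \<open>prefix r v\<close> by (metis prefix_order.trans)
        from prefix_snoc_unique[OF this q(2)] show False using q(3) by simp
      qed
      with \<open>prefix r u\<close> obtain a w where "u = r @ a # w" by (metis neq_Nil_conv prefix_def append_Nil2)
      then show ?thesis by (auto simp: prefix_def)
    qed
    have ne: "V a \<noteq> {}" for a
    proof
      assume *: "V a = {}"
      have "prefix (r @ [\<not> a]) u" if u: "u \<in> U" for u
      proof -
        obtain b where b: "prefix (r @ [b]) u" using ext[OF u] by blast
        have "b \<noteq> a"
        proof
          assume "b = a"
          then have "u \<in> V a" using b u by (simp add: V_def)
          then show False using * by simp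
        qed
        then have "b = (\<not> a)" by simp
        then show ?thesis using b by simp
      qed
      then have "common (r @ [\<not> a])" by (simp add: common_def)
      from max[OF this] show False by simp
    qed
    have disj: "V True \<inter> V False = {}" 
      using not_prefix_snoc(1) unfolding V_def by blast
    have "u \<in> V False \<union> V True" if u: "u \<in> U" for u
    proof -
      obtain a where "prefix (r @ [a]) u" using ext[OF u] by blast
      then show ?thesis using u by (cases a) (simp_all add: V_def)
    qed
    then have un: "U = V False \<union> V True" by (auto simp: V_def)
    have fin: "finite (V a)" for a using less.prems by (simp add: V_def)
    have "\<exists>t. splits (V a) t" for a
    proof (rule less.hyps)
      obtain x where "x \<in> V (\<not> a)" using ne by blast
      then have x: "x \<in> U" "prefix (r @ [\<not> a]) x" by (simp_all add: V_def)
      have "x \<notin> V a"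
      proof
        assume "x \<in> V a"
        then have "prefix (r @ [a]) x" by (simp add: V_def)
        from prefix_snoc_unique[OF this x(2)] show False by simp
      qed
      with x(1) have "V a \<subset> U" by (auto simp: V_def)
      then show "card (V a) < card U" using less.prems by (intro psubset_card_mono)
      show "diverging (V a)" using less.prems by (auto simp: V_def diverging_def)
    qed (use fin ne in auto)
    then obtain t0 t1 where "splits (V False) t0" "splits (V True) t1" by blast
    then have "splits (V False \<union> V True) (Node r t0 t1)"
      by (rule splits.Node) (simp_all add: V_def)
    then show ?thesis using un by auto
  qed
qed

text \<open>A common prefix cannot be longer than the meet \<open>r\<close>: it would then contain
  the left turn at \<open>r\<close>, which the members on the right do not take.\<close>

lemma splits_labels:
  assumes "splits U t" "w \<in> set_ltree t" "\<And>u. u \<in> U \<Longrightarrow> prefix p u"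
  shows "prefix p w"
  using assms
proof (induction rule: splits.induct)
  case (Node U0 t0 U1 t1 r)
  show ?case
  proof (cases "w = r")
    case True
    obtain u0 where u0: "u0 \<in> U0" using splits_nonempty[OF Node.hyps(1)] by blast
    obtain u1 where u1: "u1 \<in> U1" using splits_nonempty[OF Node.hyps(2)] by blast
    have p: "prefix p u0" "prefix p u1" "prefix (r @ [False]) u0" "prefix (r @ [True]) u1"
      using Node.prems(2)[of u0] Node.prems(2)[of u1] Node.hyps(3)[OF u0] Node.hyps(4)[OF u1] u0 u1 by simp_all
    show ?thesis
    proof (cases "length p \<le> length r")
      case True
      then show ?thesis
        unfolding \<open>w = r\<close> by (intro prefix_length_prefix[OF p(1) append_prefixD[OF p(3)]])
    next
      case False
      then have "prefix (r @ [False]) p" using p(1,3) by (intro prefix_length_prefix[OF p(3) p(1)]) simp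
      then have "prefix (r @ [False]) u1" using p(2) by (rule prefix_order.trans)
      then show ?thesis using p(4) not_prefix_snoc(1) by blast
    qed
  next
    case False
    then consider "w \<in> set_ltree t0" | "w \<in> set_ltree t1" using Node.prems(1) by auto
    then show ?thesis using Node.IH Node.prems(2) by (metis UnCI)
  qed
qed simp

text \<open>\<open>code u\<close> is the number with binary expansion \<open>1u\<close>.\<close>

definition code :: "bool list \<Rightarrow> nat" where
  "code u = foldl (\<lambda>n b. 2 * n + of_bool b) 1 u"

lemma code_snoc: "code (u @ [b]) = 2 * code u + of_bool b"
  by (simp add: code_def)

lemma code_pos: "0 < code u"
  by (induction u rule: rev_induct) (simp_all add: code_snoc, simp add: code_def)

lemma code_append: "v \<noteq> [] \<Longrightarrow> code u < code (u @ v)"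
proof (induction v rule: rev_induct)
  case (snoc b v)
  have "code u \<le> code (u @ v)" using snoc by (cases "v = []") auto
  also have "\<dots> < code ((u @ v) @ [b])" using code_pos[of "u @ v"] unfolding code_snoc by simp
  finally show ?case by simp
qed simp

lemma code_prefix: "prefix u v \<Longrightarrow> code u \<le> code v"
  using code_append by (auto simp: prefix_def) (metis append_Nil2 le_less)

lemma code_inj: "code u = code v \<Longrightarrow> u = v"
proof (induction u arbitrary: v rule: rev_induct)
  case Nil
  then show ?case using code_append[of v "[]"] by (cases "v = []") auto
next
  case (snoc a u)
  show ?case
  proof (cases v rule: rev_cases)
    case Nil
    then show ?thesis using snoc.prems code_append[of "u @ [a]" "[]"] by auto
  next
    case (snoc v' b)
    then have "2 * code u + of_bool a = 2 * code v' + of_bool b" using snoc.prems[unfolded snoc code_snoc] \<open>code (u @ [a]) = code v\<close> by (simp add: code_snoc)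
    then have "a = b" "code u = code v'" by (cases a; cases b; simp; presburger)+
    then show ?thesis using snoc snoc.IH by simp
  qed
qed

text \<open>Records whether \<open>u\<close> turns right at the word with code \<open>i\<close>; the
  value is False whenever \<open>u\<close> does not pass through that word, so foreign meets leave
  no trace.\<close>

definition node_bit :: "bool list \<Rightarrow> nat \<Rightarrow> bool" where
  "node_bit u i \<longleftrightarrow> (\<exists>w. code w = i \<and> prefix (w @ [True]) u)"

text \<open>The level of the meet of \<open>sparse_node u\<close> and \<open>sparse_node v\<close> is the code of the meet of \<open>u\<close> and \<open>v\<close>; hence no
  two of the meets and nodes of a set \<open>sparse_node ` U\<close> share a level.\<close>

definition sparse_node :: "bool list \<Rightarrow> bool list" where
  "sparse_node u = map (node_bit u) [0..<code u]"

lemma node_bit_code: "node_bit u (code w) \<longleftrightarrow> prefix (w @ [True]) u"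
  using code_inj by (auto simp: node_bit_def)

lemma node_bit_prefix:
  assumes "prefix r u" "i < code r"
  shows "node_bit u i \<longleftrightarrow> node_bit r i"
proof -
  have "prefix (w @ [True]) r" if w: "code w = i" "prefix (w @ [True]) u" for w
  proof -
    have "\<not> prefix r w" using code_prefix[of r w] w(1) assms(2) by auto
    moreover have "prefix r (w @ [True]) \<or> prefix (w @ [True]) r"
      using prefix_same_cases[OF assms(1) w(2)] .
    ultimately show ?thesis by auto
  qed
  moreover have "prefix (w @ [True]) u" if "prefix (w @ [True]) r" for w
    using that assms(1) by (rule prefix_order.trans)
  ultimately show ?thesis by (auto simp: node_bit_def)
qed

text \<open>The canonical set of words of type \<open>t\<close>: the leaf labels are the lengths,
  and \<open>R\<close> accumulates the levels of the meets left to the right, the only positions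
  that carry True.\<close>

primrec words :: "nat ltree \<Rightarrow> nat set \<Rightarrow> bool list set" where
  "words (Leaf l) R = {map (\<lambda>i. i \<in> R) [0..<l]}"
| "words (Node m t0 t1) R = words t0 R \<union> words t1 (insert m R)"

lemma words_length: "s \<in> words t R \<Longrightarrow> length s \<in> set_ltree t"
  by (induction t arbitrary: R) auto

lemma increasing_set: "increasing_tree t L \<Longrightarrow> set_ltree t = L"
  by (induction rule: increasing_tree.induct) auto

lemma increasing_code: "splits U t \<Longrightarrow> increasing_tree (map_ltree code t) (code ` set_ltree t)"
proof (induction rule: splits.induct)
  case (Leaf u)
  show ?case by (simp add: increasing_tree.Leaf)
next
  case (Node U0 t0 U1 t1 r)
  have 0: "prefix (r @ [False]) w" if "w \<in> set_ltree t0" for w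
    using splits_labels[OF Node.hyps(1) that] Node.hyps(3) by blast
  have 1: "prefix (r @ [True]) w" if "w \<in> set_ltree t1" for w
    using splits_labels[OF Node.hyps(2) that] Node.hyps(4) by blast
  have "set_ltree t0 \<inter> set_ltree t1 = {}" using 0 1 not_prefix_snoc(1) by blast
  then have "code ` set_ltree t0 \<inter> code ` set_ltree t1 = {}" by (auto dest!: code_inj)
  moreover have "code r < l" if "l \<in> code ` set_ltree t0 \<union> code ` set_ltree t1" for l
  proof -
    from that obtain w where w: "l = code w" "w \<in> set_ltree t0 \<or> w \<in> set_ltree t1" by blast
    then obtain a where "prefix (r @ [a]) w" using 0 1 by blast
    moreover have "code r < code (r @ [a])" by (rule code_append) simp
    ultimately show ?thesis using code_prefix[of "r @ [a]" w] w(1) by simp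
  qed
  ultimately show ?case
    using increasing_tree.Node[OF Node.IH, of "code r"] by (simp add: image_Un)
qed

lemma splits_card: "splits U t \<Longrightarrow> finite U \<and> finite (set_ltree t) \<and> Suc (card (set_ltree t)) = 2 * card U"
proof (induction rule: splits.induct)
  case (Node U0 t0 U1 t1 r)
  have 0: "prefix (r @ [False]) w" if "w \<in> set_ltree t0" for w
    using splits_labels[OF Node.hyps(1) that] Node.hyps(3) by blast
  have 1: "prefix (r @ [True]) w" if "w \<in> set_ltree t1" for w
    using splits_labels[OF Node.hyps(2) that] Node.hyps(4) by blast
  have "U0 \<inter> U1 = {}" using Node.hyps(3,4) not_prefix_snoc(1) by blast
  moreover have "set_ltree t0 \<inter> set_ltree t1 = {}" using 0 1 not_prefix_snoc(1) by blast
  moreover have "r \<notin> set_ltree t0 \<union> set_ltree t1" using 0[of r] 1[of r] by (auto simp: prefix_def)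
  ultimately show ?case using Node.IH by (auto simp: card_Un_disjoint)
qed simp

lemma splits_meet:
  assumes "splits U t" "u \<in> U" "v \<in> U" "u \<noteq> v"
  shows "\<exists>r\<in>set_ltree t. \<exists>a. prefix (r @ [a]) u \<and> prefix (r @ [\<not> a]) v"
  using assms
proof (induction rule: splits.induct)
  case (Node U0 t0 U1 t1 r)
  consider "u \<in> U0" "v \<in> U0" | "u \<in> U1" "v \<in> U1" | "u \<in> U0" "v \<in> U1" | "u \<in> U1" "v \<in> U0"
    using Node.prems by blast
  then show ?case
  proof cases
    case 1
    from Node.IH(1)[OF this Node.prems(3)] show ?thesis unfolding ltree.set by blast
  next
    case 2
    from Node.IH(2)[OF this Node.prems(3)] show ?thesis unfolding ltree.set by blast
  next
    case 3
    then show ?thesis using Node.hyps(3,4)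
      by (intro bexI[of _ r] exI[of _ False]) simp_all
  next
    case 4
    then show ?thesis using Node.hyps(3,4)
      by (intro bexI[of _ r] exI[of _ True]) simp_all
  qed
qed simp

lemma splits_members: "splits U t \<Longrightarrow> U \<subseteq> set_ltree t"
  by (induction rule: splits.induct) auto

text \<open>\<kappa> gives the rank of a node and \<Lambda> leads back from ranks to levels. For the
  induction, \<open>R\<close> has to know the bits at all ranks outside the current subtree; at the
  meets of the sibling subtree they are False, as \<open>u\<close> does not pass through
  them.\<close>

lemma words_splits:
  assumes "splits U t" "\<And>w. w \<in> set_ltree t \<Longrightarrow> \<Lambda> (\<kappa> w) = code w"
    "\<And>u i. u \<in> U \<Longrightarrow> i < \<kappa> u \<Longrightarrow> i \<notin> \<kappa> ` set_ltree t \<Longrightarrow> i \<in> R \<longleftrightarrow> node_bit u (\<Lambda> i)"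
    "R \<inter> \<kappa> ` set_ltree t = {}"
  shows "words (map_ltree \<kappa> t) R = (\<lambda>u. map (\<lambda>j. node_bit u (\<Lambda> j)) [0..<\<kappa> u]) ` U"
  using assms
proof (induction arbitrary: R rule: splits.induct)
  case (Leaf u)
  have "map (\<lambda>i. i \<in> R) [0..<\<kappa> u] = map (\<lambda>j. node_bit u (\<Lambda> j)) [0..<\<kappa> u]"
    by (rule map_cong[OF refl], rule Leaf.prems(2)) simp_all
  then show ?case by simp
next
  case (Node U0 t0 U1 t1 r)
  have 0: "prefix (r @ [False]) w" if "w \<in> set_ltree t0" for w
    using splits_labels[OF Node.hyps(1) that] Node.hyps(3) by blast
  have 1: "prefix (r @ [True]) w" if "w \<in> set_ltree t1" for w
    using splits_labels[OF Node.hyps(2) that] Node.hyps(4) by blast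
  have \<Lambda>: "\<Lambda> (\<kappa> r) = code r" "\<And>w. w \<in> set_ltree t0 \<Longrightarrow> \<Lambda> (\<kappa> w) = code w" "\<And>w. w \<in> set_ltree t1 \<Longrightarrow> \<Lambda> (\<kappa> w) = code w"
    using Node.prems(1) by simp_all
  have R: "\<kappa> r \<notin> R" "R \<inter> \<kappa> ` set_ltree t0 = {}" "R \<inter> \<kappa> ` set_ltree t1 = {}"
    using Node.prems(3) by auto
  have hyp: "i \<in> R \<longleftrightarrow> node_bit u (\<Lambda> i)"
    if "u \<in> U0 \<union> U1" "i < \<kappa> u" "i \<noteq> \<kappa> r" "i \<notin> \<kappa> ` set_ltree t0" "i \<notin> \<kappa> ` set_ltree t1" for u i
  proof (rule Node.prems(2)[OF that(1,2)])
    show "i \<notin> \<kappa> ` set_ltree (Node r t0 t1)" using that(3-5) by auto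
  qed
  have "words (map_ltree \<kappa> t0) R = (\<lambda>u. map (\<lambda>j. node_bit u (\<Lambda> j)) [0..<\<kappa> u]) ` U0"
  proof (rule Node.IH(1)[OF \<Lambda>(2) _ R(2)])
    fix u i assume u: "u \<in> U0" "i < \<kappa> u" "i \<notin> \<kappa> ` set_ltree t0"
    have pu: "prefix (r @ [False]) u" using Node.hyps(3) u by blast
    consider "i = \<kappa> r" | w where "w \<in> set_ltree t1" "i = \<kappa> w" | "i \<noteq> \<kappa> r" "i \<notin> \<kappa> ` set_ltree t1" by blast
    then show "i \<in> R \<longleftrightarrow> node_bit u (\<Lambda> i)"
    proof cases
      case 1
      have "\<not> prefix (r @ [True]) u" using pu by (rule not_prefix_snoc)
      then show ?thesis using 1 R \<Lambda>(1) by (simp add: node_bit_code)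
    next
      case 2
      have "\<not> prefix (w @ [True]) u"
      proof
        assume "prefix (w @ [True]) u"
        then have "prefix (r @ [True]) u"
          by (rule prefix_order.trans[OF 1[OF 2(1)] append_prefixD])
        then show False using pu not_prefix_snoc by blast
      qed
      moreover have "\<Lambda> i = code w" using \<Lambda>(3)[OF 2(1)] 2(2) by simp
      moreover have "i \<notin> R" using R(3) 2(1,2) by blast
      ultimately show ?thesis using 2(2) by (simp add: node_bit_code)
    next
      case 3
      then show ?thesis using hyp u by blast
    qed
  qed simp
  moreover have "words (map_ltree \<kappa> t1) (insert (\<kappa> r) R) = (\<lambda>u. map (\<lambda>j. node_bit u (\<Lambda> j)) [0..<\<kappa> u]) ` U1"
  proof (rule Node.IH(2)[OF \<Lambda>(3)])
    fix u i assume u: "u \<in> U1" "i < \<kappa> u" "i \<notin> \<kappa> ` set_ltree t1"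
    have pu: "prefix (r @ [True]) u" using Node.hyps(4) u by blast
    consider "i = \<kappa> r" | w where "w \<in> set_ltree t0" "i = \<kappa> w" "i \<noteq> \<kappa> r" | "i \<noteq> \<kappa> r" "i \<notin> \<kappa> ` set_ltree t0" by blast
    then show "i \<in> insert (\<kappa> r) R \<longleftrightarrow> node_bit u (\<Lambda> i)"
    proof cases
      case 1
      then show ?thesis using pu \<Lambda>(1) by (simp add: node_bit_code)
    next
      case 2
      have "\<not> prefix (w @ [True]) u"
      proof
        assume "prefix (w @ [True]) u"
        then have "prefix (r @ [False]) u"
          by (rule prefix_order.trans[OF 0[OF 2(1)] append_prefixD])
        then show False using pu not_prefix_snoc by blast
      qed
      moreover have "\<Lambda> i = code w" using \<Lambda>(2)[OF 2(1)] 2(2) by simp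
      moreover have "i \<notin> R" using R(2) 2(1,2) by blast
      ultimately show ?thesis using 2(3) by (simp add: node_bit_code)
    next
      case 3
      then show ?thesis using hyp u by blast
    qed
  next
    have "\<kappa> r \<noteq> \<kappa> w" if "w \<in> set_ltree t1" for w
    proof
      assume "\<kappa> r = \<kappa> w"
      then have "r = w" using \<Lambda>(1) \<Lambda>(3)[OF that] code_inj by metis
      then show False using 1[OF that] by (auto simp: prefix_def)
    qed
    then show "insert (\<kappa> r) R \<inter> \<kappa> ` set_ltree t1 = {}" using R(3) by auto
  qed simp
  ultimately show ?case by (simp add: image_Un)
qed

text \<open>Beyond \<open>card L\<close> the values merely continue the enumeration increasingly,
  since a strong embedding has to be defined on all levels.\<close>

lemma strict_mono_enumeration:
  fixes L :: "nat set"
  assumes "finite L"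
  shows "\<exists>\<Lambda>. strict_mono \<Lambda> \<and> \<Lambda> ` {..<card L} = L"
proof -
  define xs where "xs = sorted_list_of_set L"
  have xs: "sorted_wrt (<) xs" "set xs = L" "length xs = card L"
    using assms by (simp_all add: xs_def)
  define \<Lambda> where "\<Lambda> j = (if j < card L then xs ! j else Suc (Max (insert 0 L)) + j)" for j
  have "\<Lambda> ` {..<card L} = (!) xs ` {..<length xs}" using xs by (auto simp: \<Lambda>_def)
  also have "\<dots> = L" using xs(2) by (auto simp: set_conv_nth)
  finally have "\<Lambda> ` {..<card L} = L" .
  moreover have "strict_mono \<Lambda>"
  proof (rule strict_monoI)
    fix i j :: nat assume "i < j"
    have "xs ! i \<le> Max (insert 0 L)" if "i < card L"
      using assms xs that nth_mem[of i xs] by (intro Max_ge) auto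
    then have "xs ! i < Suc (Max (insert 0 L)) + j" if "i < card L"
      using that by (meson le_imp_less_Suc trans_less_add1)
    then show "\<Lambda> i < \<Lambda> j"
      using \<open>i < j\<close> xs(3) sorted_wrt_nth_less[OF xs(1) \<open>i < j\<close>] unfolding \<Lambda>_def
      by (cases "j < card L"; cases "i < card L") simp_all
  qed
  ultimately show ?thesis by blast
qed

text \<open>This bounds the height: a set of sparse nodes is the image of a canonical set that
  depends on its type only and lies in the first \<open>2 * card U - 1\<close> levels. The embedding
  stretches rank j to the level \<Lambda> j.\<close>

lemma strong_emb_onto_sparse:
  assumes U: "finite U" "U \<noteq> {}" "diverging U"
  shows "\<exists>t \<phi>. increasing_tree t {..<2 * card U - 1} \<and> strong_emb \<phi> \<and> \<phi> ` words t {} = sparse_node ` U"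
proof -
  obtain t0 where t0: "splits U t0" using splits_exists U by blast
  define L where "L = code ` set_ltree t0"
  have "inj_on code (set_ltree t0)" using code_inj by (auto simp: inj_on_def)
  then have L: "finite L" "card L = 2 * card U - 1"
    using splits_card[OF t0] by (auto simp: L_def card_image)
  from strict_mono_enumeration[OF L(1)] obtain \<Lambda> where \<Lambda>: "strict_mono \<Lambda>" "\<Lambda> ` {..<2 * card U - 1} = L"
    unfolding L by blast
  have mono: "\<Lambda> i < \<Lambda> j \<longleftrightarrow> i < j" "\<Lambda> i = \<Lambda> j \<longleftrightarrow> i = j" for i j
    using \<Lambda>(1) by (simp_all add: strict_mono_less strict_mono_eq)
  define \<kappa> where "\<kappa> w = inv \<Lambda> (code w)" for w
  have inv: "inv \<Lambda> (\<Lambda> j) = j" for j using \<Lambda>(1) strict_mono_imp_inj_on by (intro inv_f_f) blast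
  have \<kappa>: "\<Lambda> (\<kappa> w) = code w" if "w \<in> set_ltree t0" for w
  proof -
    have "code w \<in> \<Lambda> ` {..<2 * card U - 1}" using that \<Lambda>(2) by (simp add: L_def)
    then show ?thesis by (auto simp: \<kappa>_def inv)
  qed
  define t where "t = map_ltree \<kappa> t0"
  have "strict_mono_on L (inv \<Lambda>)"
    unfolding \<Lambda>(2)[symmetric] by (auto simp: strict_mono_on_def inv mono)
  then have "increasing_tree (map_ltree (inv \<Lambda>) (map_ltree code t0)) (inv \<Lambda> ` L)"
    using increasing_map increasing_code[OF t0] unfolding L_def by blast
  moreover have "inv \<Lambda> \<circ> code = \<kappa>" by (simp add: fun_eq_iff \<kappa>_def)
  then have "map_ltree (inv \<Lambda>) (map_ltree code t0) = t"
    by (simp only: t_def ltree.map_comp)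
  moreover have "inv \<Lambda> ` L = {..<2 * card U - 1}"
    unfolding \<Lambda>(2)[symmetric] by (simp add: image_image inv)
  ultimately have inc: "increasing_tree t {..<2 * card U - 1}" by simp
  have all: "i \<in> \<kappa> ` set_ltree t0" if "i < 2 * card U - 1" for i
  proof -
    have "\<Lambda> i \<in> L" using that \<Lambda>(2) by blast
    then obtain w where "w \<in> set_ltree t0" "code w = \<Lambda> i" by (auto simp: L_def)
    then show ?thesis by (auto simp: \<kappa>_def inv intro!: image_eqI[of _ _ w])
  qed
  have \<kappa>_less: "\<kappa> w < 2 * card U - 1" if "w \<in> set_ltree t0" for w
    using increasing_set[OF inc] that by (auto simp: t_def ltree.set_map)
  have \<kappa>_U: "\<kappa> u < 2 * card U - 1" "\<Lambda> (\<kappa> u) = code u" if "u \<in> U" for u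
    using splits_members[OF t0] that \<kappa>_less \<kappa> by blast+
  define p where "p u = map (\<lambda>j. node_bit u (\<Lambda> j)) [0..<\<kappa> u]" for u
  have words: "words t {} = p ` U"
    unfolding t_def p_def
  proof (rule words_splits[OF t0])
    show "\<Lambda> (\<kappa> w) = code w" if "w \<in> set_ltree t0" for w using that by (rule \<kappa>)
    show "i \<in> {} \<longleftrightarrow> node_bit u (\<Lambda> i)" if "u \<in> U" "i < \<kappa> u" "i \<notin> \<kappa> ` set_ltree t0" for u i
      using all[of i] \<kappa>_U[of u] that by simp
  qed simp_all
  \<comment> \<open>Away from the levels \<open>\<Lambda> j\<close> the embedding copies the bits of a member of \<open>sparse_node ` U\<close>
    that it has followed so far.\<close>
  define follow where "follow s i \<longleftrightarrow> (if i \<in> range \<Lambda> then s ! inv \<Lambda> i else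
    \<exists>u\<in>U. i < code u \<and> (\<forall>j. \<Lambda> j < i \<longrightarrow> node_bit u (\<Lambda> j) = s ! j) \<and> node_bit u i)" for s i
  define \<phi> where "\<phi> s = map (follow s) [0..<\<Lambda> (length s)]" for s
  have "strong_emb \<phi>"
    unfolding strong_emb_def
  proof (intro conjI allI impI)
    show "length (\<phi> s) = length (\<phi> s')" if "length s = length s'" for s s' using that by (simp add: \<phi>_def)
    show "prefix (\<phi> s @ [a]) (\<phi> (s @ [a]))" for s a
    proof -
      have less: "\<Lambda> (length s) < \<Lambda> (Suc (length s))" by (simp add: mono)
      have "follow (s @ [a]) i = follow s i" if "i < \<Lambda> (length s)" for i
      proof -
        have "(s @ [a]) ! j = s ! j" if "\<Lambda> j \<le> i" for j
        proof -
          have "\<Lambda> j < \<Lambda> (length s)" using that \<open>i < _\<close> by simp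
          then show ?thesis by (simp add: mono nth_append)
        qed
        then show ?thesis by (auto simp: follow_def inv)
      qed
      moreover have "follow (s @ [a]) (\<Lambda> (length s)) = a" by (simp add: follow_def inv)
      ultimately have "take (Suc (\<Lambda> (length s))) (\<phi> (s @ [a])) = \<phi> s @ [a]"
        using less by (intro nth_equalityI) (auto simp: \<phi>_def nth_append less_Suc_eq)
      then show ?thesis by (metis take_is_prefix)
    qed
  qed
  moreover have "\<phi> (p u) = sparse_node u" if u: "u \<in> U" for u
  proof -
    have "follow (p u) i = node_bit u i" if i: "i < code u" for i
    proof (cases "i \<in> range \<Lambda>")
      case True
      then obtain j where j: "i = \<Lambda> j" by blast
      then have "j < \<kappa> u" using i \<kappa>_U(2)[OF u] mono(1) by metis
      then show ?thesis using j by (simp add: follow_def inv p_def)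
    next
      case False
      have less: "j < \<kappa> u" if "\<Lambda> j < i" for j using that i \<kappa>_U(2)[OF u] mono(1)[of j "\<kappa> u"] by simp
      \<comment> \<open>The existential quantifier in \<open>follow\<close> is unambiguous: two
        members differ at the level of their meet, so if they agree on the critical levels before
        \<open>i\<close>, the meet lies beyond \<open>i\<close>, and before the meet all their bits
        coincide.\<close>
      have agree: "node_bit u i = node_bit v i"
        if v: "v \<in> U" "\<And>j. \<Lambda> j < i \<Longrightarrow> node_bit v (\<Lambda> j) = node_bit u (\<Lambda> j)" for v
      proof (cases "u = v")
        case False
        obtain r a where r: "r \<in> set_ltree t0" "prefix (r @ [a]) u" "prefix (r @ [\<not> a]) v"
          using splits_meet[OF t0 u v(1) False] by blast
        have "node_bit u (code r) \<noteq> node_bit v (code r)"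
          unfolding node_bit_code using r(2,3) by (cases a) (simp_all add: not_prefix_snoc)
        then have "\<not> code r < i" using v(2)[of "\<kappa> r"] \<kappa>[OF r(1)] by auto
        moreover have "code r \<noteq> i" using \<open>i \<notin> range \<Lambda>\<close> \<kappa>[OF r(1)] by (metis rangeI)
        ultimately have "i < code r" by simp
        then show ?thesis
          using node_bit_prefix[OF append_prefixD[OF r(2)]] node_bit_prefix[OF append_prefixD[OF r(3)]] by simp
      qed simp
      have "follow (p u) i \<longleftrightarrow> (\<exists>v\<in>U. i < code v \<and> (\<forall>j. \<Lambda> j < i \<longrightarrow> node_bit v (\<Lambda> j) = node_bit u (\<Lambda> j)) \<and> node_bit v i)"
        using False less by (auto simp: follow_def p_def)
      then show ?thesis using agree u i by blast
    qed
    moreover have "\<Lambda> (length (p u)) = code u" using \<kappa>_U(2)[OF u] by (simp add: p_def)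
    ultimately show ?thesis by (simp add: \<phi>_def sparse_node_def)
  qed
  then have "\<phi> ` words t {} = sparse_node ` U" unfolding words image_image by (intro image_cong) simp_all
  ultimately show ?thesis using inc by blast
qed

lemma left_of_strong_emb: "strong_emb \<phi> \<Longrightarrow> left_of s t \<Longrightarrow> left_of (\<phi> s) (\<phi> t)"
  unfolding left_of_def using strong_emb_prefix by blast

lemma left_of_sparse_node:
  assumes "left_of s t" shows "left_of (sparse_node s) (sparse_node t)"
proof -
  have *: "prefix (sparse_node r @ [a]) (sparse_node u)" if u: "prefix (r @ [a]) u" for r u a
  proof -
    have "code r < code u" using code_append[of "[a]" r] code_prefix[OF u] by simp
    moreover have "node_bit u (code r) = a"
      using u not_prefix_snoc[of r u] by (cases a) (simp_all add: node_bit_code)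
    moreover have "node_bit u i = node_bit r i" if "i < code r" for i
      using node_bit_prefix[OF append_prefixD[OF u] that] .
    ultimately have "take (Suc (code r)) (sparse_node u) = sparse_node r @ [a]"
      by (intro nth_equalityI) (auto simp: sparse_node_def nth_append less_Suc_eq)
    then show ?thesis by (metis take_is_prefix)
  qed
  then show ?thesis using assms unfolding left_of_def by blast
qed

theorem Devlin:
  fixes c :: "bool list set \<Rightarrow> 'c"
  assumes c: "finite (range c)" and n: "0 < n"
  shows "\<exists>\<psi> B. strong_emb \<psi> \<and> B \<subseteq> range c \<and> card B \<le> tan_num (2 * n - 1) \<and>
    (\<forall>U. card U = n \<longrightarrow> diverging U \<longrightarrow> c (\<psi> ` sparse_node ` U) \<in> B)"
proof -
  define k where "k = 2 * n - 1"
  define types where "types = {t. increasing_tree t {..<k}}"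
  have types: "finite types" "card types \<le> tan_num k"
    using card_increasing[of "{..<k}"] by (simp_all add: types_def)
  \<comment> \<open>One subtree has to be homogeneous for all types simultaneously, so an embedding
    is coloured by a function from types to colours.\<close>
  define d where "d \<phi> = restrict (\<lambda>t. c (\<phi> ` words t {})) types" for \<phi> :: "bool list \<Rightarrow> bool list"
  have "range d \<subseteq> types \<rightarrow>\<^sub>E range c" by (auto simp: d_def)
  then have "finite (range d)" using finite_PiE[OF types(1)] c finite_subset by metis
  from Milliken[OF this, of k] obtain \<psi> col where \<psi>': "strong_emb \<psi>"
    "\<forall>\<phi>. strong_emb \<phi> \<longrightarrow> d (trunc k (\<psi> \<circ> \<phi>)) = col"
    by (elim exE conjE)
  note \<psi> = \<psi>'(1) \<psi>'(2)[rule_format]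
  define B where "B = col ` types"
  have "B \<subseteq> range c" using \<psi>(2)[OF strong_emb_id] by (auto simp: B_def d_def)
  moreover have "card B \<le> tan_num (2 * n - 1)"
    using card_image_le[OF types(1), of col] types(2) by (simp add: B_def k_def)
  moreover have "c (\<psi> ` sparse_node ` U) \<in> B" if U: "card U = n" "diverging U" for U
  proof -
    have "finite U" "U \<noteq> {}" using U(1) n by (auto intro: card_ge_0_finite)
    from strong_emb_onto_sparse[OF this U(2)] obtain t \<phi> where
      t: "increasing_tree t {..<k}" "strong_emb \<phi>" "\<phi> ` words t {} = sparse_node ` U"
      unfolding U(1) k_def by blast
    have "length s < k" if "s \<in> words t {}" for s
      using words_length[OF that] increasing_set[OF t(1)] by auto
    then have "trunc k (\<psi> \<circ> \<phi>) ` words t {} = \<psi> ` \<phi> ` words t {}"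
      unfolding image_image by (intro image_cong) (simp_all add: trunc_def)
    then have "col t = c (\<psi> ` sparse_node ` U)"
      using fun_cong[OF \<psi>(2)[OF t(2)], of t] t by (simp add: d_def types_def)
    then show ?thesis using t(1) by (auto simp: B_def types_def intro!: image_eqI[of _ _ t])
  qed
  ultimately show ?thesis using \<psi>(1) by blast
qed

section \<open>The lexicographic order\<close>

definition agree :: "nat \<Rightarrow> (nat \<Rightarrow> nat) \<Rightarrow> (nat \<Rightarrow> nat) \<Rightarrow> bool" where
  "agree n x y \<longleftrightarrow> (\<forall>i<n. x i = y i)"

definition lex_less :: "(nat \<Rightarrow> nat) \<Rightarrow> (nat \<Rightarrow> nat) \<Rightarrow> bool" where
  "lex_less x y \<longleftrightarrow> (\<exists>n. agree n x y \<and> x n < y n)"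

lemma agree_refl: "agree n x x" and agree_sym: "agree n x y \<Longrightarrow> agree n y x"
  and agree_mono: "agree n x y \<Longrightarrow> m \<le> n \<Longrightarrow> agree m x y"
  by (simp_all add: agree_def)

lemma first_diff_agree: "agree (first_diff x y) x y"
  using first_diff_eq by (simp add: agree_def)

lemma first_diffI:
  assumes "agree n x y" "x n \<noteq> y n" shows "first_diff x y = n"
  unfolding first_diff_def using assms
  by (intro Least_equality) (auto simp: agree_def not_le[symmetric])

lemma lex_le_iff: "lex_le x y \<longleftrightarrow> x = y \<or> lex_less x y"
proof -
  have "x (first_diff x y) < y (first_diff x y) \<longleftrightarrow> lex_less x y" if "x \<noteq> y"
  proof
    show "lex_less x y" if "x (first_diff x y) < y (first_diff x y)"
      using that first_diff_agree unfolding lex_less_def by blast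
    assume "lex_less x y"
    then obtain n where n: "agree n x y" "x n < y n" unfolding lex_less_def by blast
    then have "first_diff x y = n" by (intro first_diffI) simp_all
    then show "x (first_diff x y) < y (first_diff x y)" using n by simp
  qed
  then show ?thesis by (auto simp: lex_le_def)
qed

lemma lex_less_total: "x \<noteq> y \<Longrightarrow> lex_less x y \<or> lex_less y x"
  using first_diff_neq[of x y] first_diff_agree[of x y] agree_sym[OF first_diff_agree[of x y]]
  unfolding lex_less_def by (metis linorder_neqE_nat)

lemma lex_less_trans:
  assumes "lex_less x y" "lex_less y z" shows "lex_less x z"
proof -
  obtain n where n: "agree n x y" "x n < y n" using assms unfolding lex_less_def by blast
  obtain m where m: "agree m y z" "y m < z m" using assms unfolding lex_less_def by blast
  have "agree (min n m) x z" using n(1) m(1) by (auto simp: agree_def)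
  moreover have "x (min n m) < z (min n m)"
    using n m by (cases n m rule: linorder_cases) (auto simp: agree_def)
  ultimately show ?thesis unfolding lex_less_def by blast
qed

lemma lex_less_irrefl: "\<not> lex_less x x"
  by (simp add: lex_less_def)

lemma lex_le_refl: "lex_le x x"
  by (simp add: lex_le_iff)

lemma lex_le_trans: "lex_le x y \<Longrightarrow> lex_le y z \<Longrightarrow> lex_le x z"
  using lex_less_trans unfolding lex_le_iff by metis

lemma not_lex_le: "\<not> lex_le x y \<longleftrightarrow> lex_less y x"
  using lex_less_total lex_less_trans lex_less_irrefl unfolding lex_le_iff by metis

lemma lex_le_antisym: "lex_le x y \<Longrightarrow> lex_le y x \<Longrightarrow> x = y"
  using not_lex_le unfolding lex_le_iff by metis

lemma lex_le_total: "lex_le x y \<or> lex_le y x"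
  using not_lex_le[of x y] by (auto simp: lex_le_iff)

section \<open>Cylinders, infima and suprema in the lexicographic order\<close>

definition cut :: "nat \<Rightarrow> (nat \<Rightarrow> nat) \<Rightarrow> nat \<Rightarrow> nat" where
  "cut k x i = (if i < k then x i else 0)"

lemma cut_le: "lex_le (cut k x) x"
proof (cases "cut k x = x")
  case False
  define n where "n = first_diff (cut k x) x"
  have "cut k x n \<noteq> x n" using first_diff_neq[OF False] by (simp add: n_def)
  then have "cut k x n < x n" by (auto simp: cut_def split: if_splits)
  moreover have "agree n (cut k x) x" unfolding n_def by (rule first_diff_agree)
  ultimately show ?thesis unfolding lex_le_iff lex_less_def by blast
qed (simp add: lex_le_refl)

lemma agree_cut: "agree k (cut k x) x"
  by (simp add: agree_def cut_def)

lemma cut_eq_iff: "cut k x = cut k y \<longleftrightarrow> agree k x y"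
  by (auto simp: cut_def agree_def fun_eq_iff)

text \<open>A point that vanishes from \<open>k\<close> on is the least of its cylinder of length
  \<open>k\<close>, so comparison with it is decided by the first \<open>k\<close> digits; this is
  why such points give clopen cuts.\<close>

lemma lex_le_cut:
  assumes z: "\<forall>i\<ge>k. z i = 0"
  shows "lex_le z (cut k x) \<longleftrightarrow> lex_le z x"
proof
  show "lex_le z x" if "lex_le z (cut k x)" using that cut_le by (rule lex_le_trans)
  show "lex_le z (cut k x)" if "lex_le z x"
  proof (rule ccontr)
    assume "\<not> lex_le z (cut k x)"
    then obtain n where n: "agree n (cut k x) z" "cut k x n < z n"
      unfolding not_lex_le lex_less_def by blast
    then have "n < k" using z by (cases "n < k") simp_all
    then have "agree n x z" "x n < z n" using n by (simp_all add: agree_def cut_def)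
    then have "lex_less x z" unfolding lex_less_def by blast
    then show False using that not_lex_le by blast
  qed
qed

lemma lex_le_agree:
  assumes z: "\<forall>i\<ge>k. z i = 0" and "agree k x y"
  shows "lex_le z x \<longleftrightarrow> lex_le z y"
proof -
  have "cut k x = cut k y" using assms(2) cut_eq_iff by blast
  then show ?thesis using lex_le_cut[OF z, of x] lex_le_cut[OF z, of y] by simp
qed

text \<open>Digits are chosen greedily, each the least one among the members that agree so far. The
  second conclusion places the infimum in the closure of \<open>S\<close>, which is what continuity
  arguments use.\<close>

lemma lex_inf:
  assumes "S \<noteq> {}"
  shows "\<exists>x. (\<forall>y\<in>S. lex_le x y) \<and> (\<forall>n. \<exists>y\<in>S. agree n x y)"
proof -
  define A where "A = rec_nat S (\<lambda>n A. {y \<in> A. y n = (LEAST v. \<exists>y\<in>A. y n = v)})"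
  have A_0: "A 0 = S" and A_Suc: "A (Suc n) = {y \<in> A n. y n = (LEAST v. \<exists>y\<in>A n. y n = v)}" for n
    by (simp_all add: A_def)
  define x where "x n = (LEAST v. \<exists>y\<in>A n. y n = v)" for n
  have ne: "A n \<noteq> {}" for n
  proof (induction n)
    case 0
    show ?case using assms by (simp add: A_0)
  next
    case (Suc n)
    then have "\<exists>v. \<exists>y\<in>A n. y n = v" by blast
    from LeastI_ex[OF this] show ?case unfolding A_Suc by blast
  qed
  have A: "A n = {y \<in> S. agree n x y}" for n
  proof (induction n)
    case (Suc n)
    have "A (Suc n) = {y \<in> A n. y n = x n}" by (simp add: A_Suc x_def)
    then show ?case unfolding Suc by (auto simp: agree_def less_Suc_eq)
  qed (simp add: A_0 agree_def)
  have "lex_le x y" if "y \<in> S" for y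
  proof (cases "x = y")
    case False
    define n where "n = first_diff x y"
    have ag: "agree n x y" unfolding n_def by (rule first_diff_agree)
    then have "y \<in> A n" using that A by simp
    then have "x n \<le> y n" unfolding x_def by (intro Least_le) blast
    moreover have "x n \<noteq> y n" unfolding n_def using False by (rule first_diff_neq)
    ultimately show ?thesis using ag unfolding lex_le_iff lex_less_def by (metis le_neq_implies_less)
  qed (simp add: lex_le_refl)
  moreover have "\<exists>y\<in>S. agree n x y" for n using ne[of n] A by blast
  ultimately show ?thesis by blast
qed

lemma seqs_iff: "x \<in> seqs b \<longleftrightarrow> (\<forall>i. x i < b)"
  by (auto simp: seqs_def)

lemma lex_sup:
  assumes "S \<noteq> {}" "S \<subseteq> seqs b"
  shows "\<exists>x\<in>seqs b. (\<forall>y\<in>S. lex_le y x) \<and> (\<forall>n. \<exists>y\<in>S. agree n x y)"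
proof -
  \<comment> \<open>Reversing the digits turns suprema into infima; truncated subtraction does no
    harm to digits below \<open>b\<close>.\<close>
  define flip where "flip x = (\<lambda>i. b - 1 - x i)" for x :: "nat \<Rightarrow> nat"
  obtain x where x: "\<And>y. y \<in> S \<Longrightarrow> lex_le x (flip y)" "\<And>n. \<exists>y\<in>S. agree n x (flip y)"
    using lex_inf[of "flip ` S"] assms(1) by auto
  have S: "y i < b" if "y \<in> S" for y i using that assms(2) seqs_iff by blast
  obtain y0 where "y0 \<in> S" using assms(1) by blast
  from S[OF this, of 0] have b: "0 < b" by simp
  have xb: "x i < b" for i
  proof -
    obtain y where "agree (Suc i) x (flip y)" using x(2) by blast
    then have "x i = b - 1 - y i" by (simp add: agree_def flip_def)
    then show ?thesis using b by simp
  qed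
  have fx: "flip x \<in> seqs b" using b by (simp add: seqs_iff flip_def)
  have flip_flip: "flip (flip y) = y" if "y \<in> S" for y
  proof (rule ext)
    fix i
    have "y i \<le> b - 1" using S[OF that, of i] by simp
    then show "flip (flip y) i = y i" by (simp add: flip_def)
  qed
  have flip_agree: "agree n (flip v) (flip w)" if "agree n v w" for n v w
    using that by (simp add: agree_def flip_def)
  have "lex_le y (flip x)" if y: "y \<in> S" for y
  proof (cases "x = flip y")
    case True
    then show ?thesis using flip_flip[OF y] lex_le_refl by simp
  next
    case False
    then obtain n where n: "agree n x (flip y)" "x n < flip y n"
      using x(1)[OF y] unfolding lex_le_iff lex_less_def by blast
    have "agree n y (flip x)" using flip_agree[OF n(1)] flip_flip[OF y] agree_sym by simp
    moreover have "y n < flip x n" using n(2) by (simp add: flip_def)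
    ultimately show ?thesis unfolding lex_le_iff lex_less_def by blast
  qed
  moreover have "\<exists>y\<in>S. agree n (flip x) y" for n
  proof -
    obtain y where y: "y \<in> S" "agree n x (flip y)" using x(2) by blast
    then have "agree n (flip x) y" using flip_agree[OF y(2)] flip_flip[OF y(1)] by simp
    then show ?thesis using y(1) by blast
  qed
  ultimately show ?thesis using fx by blast
qed

section \<open>Metric and continuity in terms of initial segments\<close>

lemma rho_le_iff: "rho x y \<le> (1 / 2) ^ k \<longleftrightarrow> agree k x y"
proof (cases "x = y")
  case True
  then show ?thesis by (simp add: rho_def agree_refl)
next
  case False
  have "agree k x y \<longleftrightarrow> k \<le> first_diff x y"
    using first_diff_neq[OF False] first_diff_agree[of x y] by (metis agree_def agree_mono not_le)
  moreover have "(1 / 2 :: real) ^ first_diff x y \<le> (1 / 2) ^ k \<longleftrightarrow> k \<le> first_diff x y"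
    by (rule power_decreasing_iff) simp_all
  ultimately show ?thesis using False by (simp add: rho_def)
qed

lemma continuous_seqs_iff:
  assumes f: "f \<in> seqs b \<rightarrow> seqs b"
  shows "continuous_map (Metric_space.mtopology (seqs b) rho) (Metric_space.mtopology (seqs b) rho) f \<longleftrightarrow>
    (\<forall>x\<in>seqs b. \<forall>k. \<exists>n. \<forall>y\<in>seqs b. agree n x y \<longrightarrow> agree k (f x) (f y))"
  (is "?L \<longleftrightarrow> ?R")
proof -
  interpret Metric_space "seqs b" rho by (rule Metric_space_seqs)
  have L: "?L \<longleftrightarrow> (\<forall>a\<in>seqs b. \<forall>\<epsilon>>0. \<exists>\<delta>>0. \<forall>x. x \<in> seqs b \<and> rho a x < \<delta> \<longrightarrow> rho (f a) (f x) < \<epsilon>)"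
    using f by (auto simp: metric_continuous_map[OF Metric_space_seqs])
  have small: "\<exists>k. (1 / 2 :: real) ^ k < e" if "0 < e" for e :: real
    using real_arch_pow_inv[of e "1 / 2"] that by simp
  show ?thesis
  proof
    assume ?L
    show ?R
    proof (intro ballI allI)
      fix x k assume x: "x \<in> seqs b"
      obtain \<delta> where \<delta>: "\<delta> > 0" "\<And>y. y \<in> seqs b \<Longrightarrow> rho x y < \<delta> \<Longrightarrow> rho (f x) (f y) < (1 / 2) ^ k"
        using \<open>?L\<close> x unfolding L by (metis zero_less_divide_1_iff zero_less_numeral zero_less_power)
      obtain n where "(1 / 2) ^ n < \<delta>" using small \<delta>(1) by blast
      then have "agree k (f x) (f y)" if "y \<in> seqs b" "agree n x y" for y
        using \<delta>(2)[OF that(1)] that(2) rho_le_iff[of x y n] rho_le_iff[of "f x" "f y" k] by simp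
      then show "\<exists>n. \<forall>y\<in>seqs b. agree n x y \<longrightarrow> agree k (f x) (f y)" by blast
    qed
  next
    assume R: ?R
    show ?L unfolding L
    proof (intro ballI allI impI)
      fix x and \<epsilon> :: real assume x: "x \<in> seqs b" and "\<epsilon> > 0"
      then obtain k where k: "(1 / 2) ^ k < \<epsilon>" using small by blast
      obtain n where n: "\<And>y. y \<in> seqs b \<Longrightarrow> agree n x y \<Longrightarrow> agree k (f x) (f y)" using R x by blast
      have "rho (f x) (f y) < \<epsilon>" if "y \<in> seqs b" "rho x y < (1 / 2) ^ n" for y
        using n[OF that(1)] that(2) rho_le_iff[of x y n] rho_le_iff[of "f x" "f y" k] k by simp
      then show "\<exists>\<delta>>0. \<forall>y. y \<in> seqs b \<and> rho x y < \<delta> \<longrightarrow> rho (f x) (f y) < \<epsilon>"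
        by (intro exI[of _ "(1 / 2) ^ n"]) simp
    qed
  qed
qed

lemma C_sur_mono_iff:
  "f \<in> C_sur_mono b \<longleftrightarrow> f \<in> seqs b \<rightarrow>\<^sub>E seqs b \<and>
    (\<forall>x\<in>seqs b. \<forall>k. \<exists>n. \<forall>y\<in>seqs b. agree n x y \<longrightarrow> agree k (f x) (f y)) \<and>
    f ` seqs b = seqs b \<and> (\<forall>x\<in>seqs b. \<forall>y\<in>seqs b. lex_le x y \<longrightarrow> lex_le (f x) (f y))"
proof (cases "f \<in> seqs b \<rightarrow>\<^sub>E seqs b")
  case True
  then have "f \<in> seqs b \<rightarrow> seqs b" by auto
  from continuous_seqs_iff[OF this] show ?thesis using True unfolding C_sur_mono_def by blast
qed (simp add: C_sur_mono_def)

lemma compose_C_sur_mono: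
  assumes f: "f \<in> C_sur_mono b" and h: "h \<in> C_sur_mono b"
  shows "compose (seqs b) f h \<in> C_sur_mono b"
  unfolding C_sur_mono_iff
proof (intro conjI ballI allI impI)
  have hb: "h x \<in> seqs b" if "x \<in> seqs b" for x using h that unfolding C_sur_mono_iff by auto
  have fb: "f x \<in> seqs b" if "x \<in> seqs b" for x using f that unfolding C_sur_mono_iff by auto
  show "compose (seqs b) f h \<in> seqs b \<rightarrow>\<^sub>E seqs b" using hb fb by (auto simp: compose_def)
  show "compose (seqs b) f h ` seqs b = seqs b"
  proof -
    have "compose (seqs b) f h ` seqs b = f ` h ` seqs b" by (auto simp: compose_def)
    then show ?thesis using f h unfolding C_sur_mono_iff by simp
  qed
  fix x assume x: "x \<in> seqs b"
  show "\<exists>n. \<forall>y\<in>seqs b. agree n x y \<longrightarrow> agree k (compose (seqs b) f h x) (compose (seqs b) f h y)" for k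
  proof -
    obtain m where "\<forall>y\<in>seqs b. agree m (h x) y \<longrightarrow> agree k (f (h x)) (f y)"
      using f hb[OF x] unfolding C_sur_mono_iff by blast
    moreover obtain n where "\<forall>y\<in>seqs b. agree n x y \<longrightarrow> agree m (h x) (h y)"
      using h x unfolding C_sur_mono_iff by blast
    ultimately show ?thesis using x hb by (intro exI[of _ n]) (simp add: compose_def)
  qed
  show "lex_le (compose (seqs b) f h x) (compose (seqs b) f h y)" if "y \<in> seqs b" "lex_le x y" for y
    using f h x that hb unfolding C_sur_mono_iff by (simp add: compose_def)
qed

lemma id_C_sur_mono: "restrict id (seqs b) \<in> C_sur_mono b"
  unfolding C_sur_mono_iff by auto

section \<open>Duality with the order of cuts\<close>

text \<open>The point \<open>x\<close> of \<open>cuts b\<close> stands for the cut below \<open>x\<close>; these are exactly the proper clopen cuts of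
  \<open>seqs b\<close>, and \<open>level_cuts b k\<close> separates the cylinders of length \<open>k\<close>.\<close>

definition level_cuts :: "nat \<Rightarrow> nat \<Rightarrow> (nat \<Rightarrow> nat) set" where
  "level_cuts b k = {x \<in> seqs b. x \<noteq> (\<lambda>_. 0) \<and> (\<forall>i\<ge>k. x i = 0)}"

definition cuts :: "nat \<Rightarrow> (nat \<Rightarrow> nat) set" where
  "cuts b = (\<Union>k. level_cuts b k)"

definition upper :: "nat \<Rightarrow> (nat \<Rightarrow> nat) \<Rightarrow> (nat \<Rightarrow> nat) set" where
  "upper b x = {y \<in> seqs b. lex_le x y}"

text \<open>Each cylinder of length \<open>k\<close> except the leftmost contributes its least
  point; this is the n of the coloured n-element sets.\<close>

lemma finite_card_level_cuts:
  assumes "0 < b" shows "finite (level_cuts b k)" "card (level_cuts b k) = b ^ k - 1"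
proof -
  define E where "E = {x :: nat \<Rightarrow> nat. (\<forall>i<k. x i < b) \<and> (\<forall>i\<ge>k. x i = 0)}"
  have bij: "bij_betw (\<lambda>x. restrict x {..<k}) E ({..<k} \<rightarrow>\<^sub>E {..<b})"
    by (rule bij_betw_byWitness[where f' = "\<lambda>x i. if i < k then x i else 0"])
      (auto simp: E_def fun_eq_iff PiE_def Pi_def extensional_def)
  have "finite ({..<k} \<rightarrow>\<^sub>E {..<b})" by (intro finite_PiE) simp_all
  then have E: "finite E" "card E = b ^ k"
    using bij_betw_finite[OF bij] bij_betw_same_card[OF bij] by (simp_all add: card_PiE)
  have "x \<in> seqs b" if "x \<in> E" for x
    using that assms unfolding seqs_iff E_def by (metis (mono_tags, lifting) mem_Collect_eq not_le)
  then have "level_cuts b k = E - {\<lambda>_. 0}" by (auto simp: level_cuts_def E_def seqs_iff)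
  moreover have "(\<lambda>_. 0) \<in> E" using assms by (simp add: E_def)
  ultimately show "finite (level_cuts b k)" "card (level_cuts b k) = b ^ k - 1" using E by simp_all
qed

lemma cutsI: "x \<in> seqs b \<Longrightarrow> x \<noteq> (\<lambda>_. 0) \<Longrightarrow> \<forall>i\<ge>k. x i = 0 \<Longrightarrow> x \<in> cuts b"
  unfolding cuts_def level_cuts_def by blast

lemma cutsE:
  assumes "x \<in> cuts b"
  obtains k where "x \<in> seqs b" "x \<noteq> (\<lambda>_. 0)" "\<forall>i\<ge>k. x i = 0"
  using assms unfolding cuts_def level_cuts_def by blast

lemma cuts_seqs: "x \<in> cuts b \<Longrightarrow> x \<in> seqs b"
  by (erule cutsE)

lemma zero_le: "lex_le (\<lambda>_. 0) x"
  using cut_le[of 0 x] by (simp add: cut_def[abs_def])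

lemma zero_seqs: "0 < b \<Longrightarrow> (\<lambda>_. 0) \<in> seqs b"
  by (simp add: seqs_iff)

lemma cut_seqs: "0 < b \<Longrightarrow> x \<in> seqs b \<Longrightarrow> cut k x \<in> seqs b"
  by (simp add: seqs_iff cut_def)

lemma le_zero: "lex_le x (\<lambda>_. 0) \<Longrightarrow> x = (\<lambda>_. 0)"
  using zero_le lex_le_antisym by blast

lemma separating_cut:
  assumes "lex_less x y" "y \<in> seqs b"
  shows "\<exists>z\<in>cuts b. lex_less x z \<and> lex_le z y"
proof -
  obtain n where n: "agree n x y" "x n < y n" using assms(1) unfolding lex_less_def by blast
  define z where "z = cut (Suc n) y"
  have zn: "z n = y n" by (simp add: z_def cut_def)
  have "0 < b" using assms(2) unfolding seqs_iff by (metis gr_zeroI not_less_zero)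
  have "z \<in> cuts b"
  proof (rule cutsI[of _ _ "Suc n"])
    show "z \<in> seqs b" unfolding z_def using \<open>0 < b\<close> assms(2) by (rule cut_seqs)
    show "z \<noteq> (\<lambda>_. 0)" using n(2) zn by (metis not_less_zero)
    show "\<forall>i\<ge>Suc n. z i = 0" by (simp add: z_def cut_def)
  qed
  moreover have "agree n x z" using n(1) by (simp add: agree_def z_def cut_def)
  then have "lex_less x z" using n(2) zn unfolding lex_less_def by metis
  moreover have "lex_le z y" unfolding z_def by (rule cut_le)
  ultimately show ?thesis by blast
qed

text \<open>\<open>cut k x\<close> is the largest level cut below \<open>x\<close>, or zero if there
  is none, and it determines the cylinder of \<open>x\<close>.\<close>

lemma agree_iff_level_cuts:
  assumes "0 < b" "x \<in> seqs b" "y \<in> seqs b"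
  shows "agree k x y \<longleftrightarrow> (\<forall>z\<in>level_cuts b k. lex_le z x \<longleftrightarrow> lex_le z y)"
proof
  assume "agree k x y"
  then show "\<forall>z\<in>level_cuts b k. lex_le z x \<longleftrightarrow> lex_le z y"
    using lex_le_agree unfolding level_cuts_def by blast
next
  assume eq: "\<forall>z\<in>level_cuts b k. lex_le z x \<longleftrightarrow> lex_le z y"
  have le: "lex_le (cut k v) w"
    if v: "v \<in> seqs b" "\<forall>z\<in>level_cuts b k. lex_le z v \<longrightarrow> lex_le z w" for v w
  proof (cases "cut k v = (\<lambda>_. 0)")
    case True
    then show ?thesis using zero_le by simp
  next
    case False
    then have "cut k v \<in> level_cuts b k"
      using cut_seqs[OF assms(1) v(1)] by (simp add: level_cuts_def cut_def[of k v])
    then show ?thesis using v(2) cut_le by blast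
  qed
  have "lex_le (cut k x) (cut k y)" "lex_le (cut k y) (cut k x)"
    using le[OF assms(2), of y] le[OF assms(3), of x] eq lex_le_cut[of k "cut k x" y] lex_le_cut[of k "cut k y" x]
    by (simp_all add: cut_def[of k])
  then have "cut k x = cut k y" by (rule lex_le_antisym)
  then show "agree k x y" using cut_eq_iff by blast
qed

text \<open>Kept as an unordered set, to match a colouring of sets of words.\<close>

definition signature :: "nat \<Rightarrow> nat \<Rightarrow> ((nat \<Rightarrow> nat) \<Rightarrow> (nat \<Rightarrow> nat)) \<Rightarrow> (nat \<Rightarrow> nat) set set" where
  "signature b k g = (\<lambda>z. {y \<in> seqs b. lex_le z (g y)}) ` level_cuts b k"

lemma inj_on_preimages:
  assumes "g ` seqs b = seqs b"
  shows "inj_on (\<lambda>z. {y \<in> seqs b. lex_le z (g y)}) (level_cuts b k)"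
proof (rule inj_onI)
  fix z w assume z: "z \<in> level_cuts b k" and w: "w \<in> level_cuts b k"
    and eq: "{y \<in> seqs b. lex_le z (g y)} = {y \<in> seqs b. lex_le w (g y)}"
  have iff: "lex_le z x \<longleftrightarrow> lex_le w x" if "x \<in> seqs b" for x
  proof -
    have "x \<in> g ` seqs b" using that by (simp only: assms)
    then obtain y where "y \<in> seqs b" "x = g y" by blast
    then show ?thesis using eqset_imp_iff[OF eq, of y] by simp
  qed
  have "z \<in> seqs b" "w \<in> seqs b" using z w by (simp_all add: level_cuts_def)
  then have "lex_le w z" "lex_le z w" using iff[of z] iff[of w] lex_le_refl[of z] lex_le_refl[of w] by simp_all
  then show "z = w" by (intro lex_le_antisym)
qed

text \<open>How many members of the signature contain \<open>y\<close> determines the cylinder of \<open>g y\<close>.\<close>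

lemma signature_agree:
  assumes b: "0 < b" and f: "f \<in> C_sur_mono b" and g: "g \<in> C_sur_mono b"
    and eq: "signature b k f = signature b k g" and y: "y \<in> seqs b"
  shows "agree k (f y) (g y)"
proof -
  have count: "card {z \<in> level_cuts b k. lex_le z (g y)} = card {S \<in> signature b k g. y \<in> S}"
    if "g \<in> C_sur_mono b" for g
  proof -
    have "{S \<in> signature b k g. y \<in> S} = (\<lambda>z. {y \<in> seqs b. lex_le z (g y)}) ` {z \<in> level_cuts b k. lex_le z (g y)}"
      using y by (auto simp: signature_def)
    moreover have "g ` seqs b = seqs b" using that unfolding C_sur_mono_iff by blast
    then have "inj_on (\<lambda>z. {y \<in> seqs b. lex_le z (g y)}) {z \<in> level_cuts b k. lex_le z (g y)}"
      by (rule inj_on_subset[OF inj_on_preimages]) (rule Collect_subset)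
    ultimately show ?thesis by (simp add: card_image)
  qed
  have fin: "finite (level_cuts b k)" using b by (rule finite_card_level_cuts)
  have "f y \<in> seqs b" "g y \<in> seqs b" using f g y unfolding C_sur_mono_iff by auto
  have sub: "{z \<in> level_cuts b k. lex_le z v} \<subseteq> {z \<in> level_cuts b k. lex_le z w}" if "lex_le v w" for v w
    using lex_le_trans[OF _ that] by auto
  have "{z \<in> level_cuts b k. lex_le z (f y)} = {z \<in> level_cuts b k. lex_le z (g y)}"
  proof (cases "lex_le (f y) (g y)")
    case True
    then show ?thesis using sub[OF True] fin count[OF f] count[OF g] eq by (intro card_subset_eq) simp_all
  next
    case False
    then have "lex_le (g y) (f y)" using lex_le_total by blast
    from sub[OF this] have "{z \<in> level_cuts b k. lex_le z (g y)} = {z \<in> level_cuts b k. lex_le z (f y)}"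
      using fin count[OF f] count[OF g] eq by (intro card_subset_eq) simp_all
    then show ?thesis by simp
  qed
  then have "\<forall>z\<in>level_cuts b k. lex_le z (f y) \<longleftrightarrow> lex_le z (g y)"
    by blast
  then show ?thesis using agree_iff_level_cuts[OF b \<open>f y \<in> seqs b\<close> \<open>g y \<in> seqs b\<close>] by blast
qed

text \<open>The preimage is clopen. Being closed, it contains its infimum \<open>x\<close>; being
  open, it contains \<open>cut n x\<close> for some \<open>n\<close>, which forces \<open>x\<close>
  to vanish from \<open>n\<close> on. Surjectivity prevents \<open>x\<close> from being
  zero.\<close>

lemma preimage_upper:
  assumes b: "0 < b" and f: "f \<in> C_sur_mono b" and z: "z \<in> cuts b"
  shows "\<exists>x\<in>cuts b. {y \<in> seqs b. lex_le z (f y)} = upper b x"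
proof -
  obtain k where zk: "z \<in> seqs b" "z \<noteq> (\<lambda>_. 0)" "\<forall>i\<ge>k. z i = 0" using z by (rule cutsE)
  have fb: "f y \<in> seqs b" if "y \<in> seqs b" for y using f that unfolding C_sur_mono_iff by auto
  have cont: "\<exists>n. \<forall>y\<in>seqs b. agree n x y \<longrightarrow> agree k (f x) (f y)" if "x \<in> seqs b" for x k
    using f that unfolding C_sur_mono_iff by blast
  have mono: "lex_le (f x) (f y)" if "x \<in> seqs b" "y \<in> seqs b" "lex_le x y" for x y
    using f that unfolding C_sur_mono_iff by blast
  have onto: "\<exists>y\<in>seqs b. f y = x" if "x \<in> seqs b" for x
    using f that unfolding C_sur_mono_iff by (metis imageE)
  define S where "S = {y \<in> seqs b. lex_le z (f y)}"
  obtain y0 where "y0 \<in> seqs b" "f y0 = z" using onto[OF zk(1)] by blast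
  then have "S \<noteq> {}" using lex_le_refl by (auto simp: S_def)
  from lex_inf[OF this] obtain x where x: "\<And>y. y \<in> S \<Longrightarrow> lex_le x y" "\<And>n. \<exists>y\<in>S. agree n x y" by blast
  have xb: "x \<in> seqs b"
    unfolding seqs_iff
  proof
    fix i
    obtain y where "y \<in> S" "agree (Suc i) x y" using x(2) by blast
    then show "x i < b" by (simp add: S_def seqs_iff agree_def)
  qed
  have "x \<in> S"
  proof (rule ccontr)
    assume "x \<notin> S"
    then have "lex_less (f x) z" using xb not_lex_le by (simp add: S_def)
    then obtain n where n: "agree n (f x) z" "f x n < z n" unfolding lex_less_def by blast
    obtain m where m: "\<And>y. y \<in> seqs b \<Longrightarrow> agree m x y \<Longrightarrow> agree (Suc n) (f x) (f y)" using cont[OF xb] by blast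
    obtain y where y: "y \<in> S" "agree m x y" using x(2) by blast
    then have "agree (Suc n) (f x) (f y)" using m by (simp add: S_def)
    then have "agree n (f y) z" "f y n < z n" using n by (simp_all add: agree_def)
    then have "lex_less (f y) z" unfolding lex_less_def by blast
    then show False using y(1) not_lex_le by (auto simp: S_def)
  qed
  then have le: "lex_le z (f x)" by (simp add: S_def)
  have "S = upper b x"
    using x(1) mono[OF xb] lex_le_trans[OF le] by (auto simp: S_def upper_def)
  moreover have "x \<in> cuts b"
  proof -
    obtain n where n: "\<And>y. y \<in> seqs b \<Longrightarrow> agree n x y \<Longrightarrow> agree k (f x) (f y)" using cont[OF xb] by blast
    have "agree k (f x) (f (cut n x))"
      using n[OF cut_seqs[OF b xb] agree_sym[OF agree_cut]] .
    then have "lex_le z (f (cut n x))" using lex_le_agree[OF zk(3)] le by blast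
    then have "cut n x \<in> S" using cut_seqs[OF b xb] by (simp add: S_def)
    then have eq: "cut n x = x" using x(1) cut_le lex_le_antisym by blast
    show ?thesis
    proof (rule cutsI[of _ _ n])
      show "\<forall>i\<ge>n. x i = 0"
      proof (intro allI impI)
        show "x i = 0" if "n \<le> i" for i using fun_cong[OF eq, of i] that by (simp add: cut_def)
      qed
      show "x \<noteq> (\<lambda>_. 0)"
      proof
        assume x0: "x = (\<lambda>_. 0)"
        obtain w where w: "w \<in> seqs b" "f w = (\<lambda>_. 0)" using onto[OF zero_seqs[OF b]] by blast
        have "lex_le (f x) (f w)" using mono[OF xb w(1)] zero_le x0 by blast
        then have "lex_le z (\<lambda>_. 0)" using le w(2) lex_le_trans by metis
        then show False using le_zero zk(2) by blast
      qed
    qed (rule xb)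
  qed
  ultimately show ?thesis unfolding S_def by blast
qed

text \<open>\<open>h y\<close> is the supremum of the cuts \<open>z\<close> with \<open>\<eta> z\<close> below \<open>y\<close>, so \<open>h\<close> pulls back \<open>z\<close> to \<open>\<eta> z\<close>.\<close>

lemma dual_map:
  assumes b: "0 < b" and \<eta>: "\<And>z. z \<in> cuts b \<Longrightarrow> \<eta> z \<in> cuts b"
    and mono: "\<And>z w. z \<in> cuts b \<Longrightarrow> w \<in> cuts b \<Longrightarrow> lex_less z w \<Longrightarrow> lex_less (\<eta> z) (\<eta> w)"
  shows "\<exists>h\<in>C_sur_mono b. \<forall>z\<in>cuts b. \<forall>y\<in>seqs b. lex_le z (h y) \<longleftrightarrow> lex_le (\<eta> z) y"
proof -
  have mono_le: "lex_le (\<eta> z) (\<eta> w)" if "z \<in> cuts b" "w \<in> cuts b" "lex_le z w" for z w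
    using mono that lex_le_iff by metis
  \<comment> \<open>The zero sequence keeps the set nonempty and gives the value at points below
    every \<eta> z.\<close>
  define G where "G y = insert (\<lambda>_. 0) {z \<in> cuts b. lex_le (\<eta> z) y}" for y
  have "\<exists>x\<in>seqs b. (\<forall>z\<in>G y. lex_le z x) \<and> (\<forall>n. \<exists>z\<in>G y. agree n x z)" for y
    using cuts_seqs zero_seqs[OF b] by (intro lex_sup) (auto simp: G_def)
  then obtain h0 where h0: "\<And>y. h0 y \<in> seqs b" "\<And>y z. z \<in> G y \<Longrightarrow> lex_le z (h0 y)"
    "\<And>y n. \<exists>z\<in>G y. agree n (h0 y) z"
    by metis
  have adj: "lex_le z (h0 y) \<longleftrightarrow> lex_le (\<eta> z) y" if z: "z \<in> cuts b" for z y
  proof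
    show "lex_le z (h0 y)" if "lex_le (\<eta> z) y" using h0(2)[of z y] z that by (simp add: G_def)
    assume le: "lex_le z (h0 y)"
    obtain k where k: "z \<noteq> (\<lambda>_. 0)" "\<forall>i\<ge>k. z i = 0" using z by (rule cutsE)
    \<comment> \<open>Comparison with \<open>z\<close> sees only \<open>k\<close> digits, and some
      member of \<open>G y\<close> has these in common with the supremum.\<close>
    obtain w where w: "w \<in> G y" "agree k (h0 y) w" using h0(3) by blast
    have zw: "lex_le z w" using lex_le_agree[OF k(2) w(2)] le by blast
    then have "w \<noteq> (\<lambda>_. 0)" using le_zero k(1) by blast
    then have "w \<in> cuts b" "lex_le (\<eta> w) y" using w(1) by (simp_all add: G_def)
    then show "lex_le (\<eta> z) y" using mono_le[OF z _ zw] lex_le_trans by blast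
  qed
  define h where "h = restrict h0 (seqs b)"
  have h: "h y = h0 y" if "y \<in> seqs b" for y using that by (simp add: h_def)
  have "h \<in> C_sur_mono b"
    unfolding C_sur_mono_iff
  proof (intro conjI ballI allI impI)
    show "h \<in> seqs b \<rightarrow>\<^sub>E seqs b" using h0(1) by (auto simp: h_def)
  next
    fix x y assume xy: "x \<in> seqs b" "y \<in> seqs b" "lex_le x y"
    show "lex_le (h x) (h y)"
    proof (rule ccontr)
      assume "\<not> lex_le (h x) (h y)"
      then have "lex_less (h0 y) (h0 x)" using not_lex_le h xy by simp
      then obtain z where z: "z \<in> cuts b" "lex_less (h0 y) z" "lex_le z (h0 x)"
        using separating_cut h0(1) by blast
      then have "lex_le (\<eta> z) y" using adj[OF z(1)] xy(3) lex_le_trans by blast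
      then have "lex_le z (h0 y)" using adj[OF z(1)] by blast
      then show False using z(2) not_lex_le by blast
    qed
  next
    fix x k assume x: "x \<in> seqs b"
    \<comment> \<open>Continuity: the first \<open>k\<close> digits of a value are decided by the
      finitely many level cuts, and each \<eta> z looks at finitely many digits of the
      argument.\<close>
    have "\<exists>n. \<forall>z\<in>level_cuts b k. \<forall>i\<ge>n. \<eta> z i = 0"
    proof -
      have "\<exists>n. \<forall>i\<ge>n. \<eta> z i = 0" if "z \<in> level_cuts b k" for z
      proof -
        have "\<eta> z \<in> cuts b" using that \<eta> by (auto simp: cuts_def)
        then show ?thesis by (metis cutsE)
      qed
      then obtain N where N: "\<And>z i. z \<in> level_cuts b k \<Longrightarrow> N z \<le> i \<Longrightarrow> \<eta> z i = 0" by metis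
      define n where "n = Max (insert 0 (N ` level_cuts b k))"
      have "N z \<le> n" if "z \<in> level_cuts b k" for z
        unfolding n_def using that finite_card_level_cuts(1)[OF b] by (intro Max_ge) simp_all
      then show ?thesis using N le_trans by blast
    qed
    then obtain n where n: "\<And>z. z \<in> level_cuts b k \<Longrightarrow> \<forall>i\<ge>n. \<eta> z i = 0" by blast
    have "agree k (h x) (h y)" if y: "y \<in> seqs b" "agree n x y" for y
    proof -
      have "lex_le z (h0 x) \<longleftrightarrow> lex_le z (h0 y)" if z: "z \<in> level_cuts b k" for z
      proof -
        have "z \<in> cuts b" using z by (auto simp: cuts_def)
        moreover have "lex_le (\<eta> z) x \<longleftrightarrow> lex_le (\<eta> z) y"
          using n[OF z] y(2) by (rule lex_le_agree)
        ultimately show ?thesis using adj by blast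
      qed
      then show ?thesis using agree_iff_level_cuts[OF b h0(1) h0(1)] h x y(1) by simp
    qed
    then show "\<exists>n. \<forall>y\<in>seqs b. agree n x y \<longrightarrow> agree k (h x) (h y)" by blast
  next
    have "\<exists>y\<in>seqs b. h0 y = t" if t: "t \<in> seqs b" for t
    proof -
      \<comment> \<open>The preimage of \<open>t\<close> will be the supremum of the points mapped
        to at most \<open>t\<close>.\<close>
      define S where "S = {y \<in> seqs b. lex_le (h0 y) t}"
      have "\<not> lex_less (\<lambda>_. 0) (h0 (\<lambda>_. 0))"
      proof
        assume "lex_less (\<lambda>_. 0) (h0 (\<lambda>_. 0))"
        then obtain z where z: "z \<in> cuts b" "lex_le z (h0 (\<lambda>_. 0))" using separating_cut h0(1) by blast
        then have "\<eta> z = (\<lambda>_. 0)" using adj[OF z(1)] le_zero by blast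
        moreover have "\<eta> z \<noteq> (\<lambda>_. 0)" using \<eta>[OF z(1)] by (rule cutsE)
        ultimately show False by blast
      qed
      then have "lex_le (h0 (\<lambda>_. 0)) t" using not_lex_le zero_le lex_le_trans by blast
      then have "S \<noteq> {}" using zero_seqs[OF b] by (auto simp: S_def)
      moreover have "S \<subseteq> seqs b" by (auto simp: S_def)
      ultimately obtain y where y: "y \<in> seqs b" "\<And>x. x \<in> S \<Longrightarrow> lex_le x y" "\<And>n. \<exists>x\<in>S. agree n y x"
        using lex_sup by metis
      have "\<not> lex_less t (h0 y)"
      proof
        assume "lex_less t (h0 y)"
        then obtain z where z: "z \<in> cuts b" "lex_less t z" "lex_le z (h0 y)" using separating_cut h0(1) by blast
        then have le: "lex_le (\<eta> z) y" using adj by blast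
        obtain k where k: "\<forall>i\<ge>k. \<eta> z i = 0" using \<eta>[OF z(1)] by (rule cutsE)
        obtain x where x: "x \<in> S" "agree k y x" using y(3) by blast
        have "lex_le (\<eta> z) x" using lex_le_agree[OF k x(2)] le by blast
        then have "lex_le z (h0 x)" using adj[OF z(1)] by blast
        then have "lex_le z t" using x(1) lex_le_trans by (auto simp: S_def)
        then show False using z(2) not_lex_le by blast
      qed
      moreover have "\<not> lex_less (h0 y) t"
      proof
        assume "lex_less (h0 y) t"
        then obtain z where z: "z \<in> cuts b" "lex_less (h0 y) z" "lex_le z t" using separating_cut t by blast
        \<comment> \<open>The value at \<eta> z does not exceed \<open>z\<close>: a cut
          \<open>w\<close> between them would give \<eta> w \<le> \<eta> z although z < w.\<close>
        have "\<not> lex_less z (h0 (\<eta> z))"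
        proof
          assume "lex_less z (h0 (\<eta> z))"
          then obtain w where w: "w \<in> cuts b" "lex_less z w" "lex_le w (h0 (\<eta> z))" using separating_cut h0(1) by blast
          then show False using adj[OF w(1)] mono[OF z(1) w(1,2)] not_lex_le by blast
        qed
        then have "lex_le (h0 (\<eta> z)) t" using not_lex_le z(3) lex_le_trans by blast
        then have "\<eta> z \<in> S" using cuts_seqs[OF \<eta>[OF z(1)]] by (simp add: S_def)
        then have "lex_le z (h0 y)" using y(2) adj[OF z(1)] by blast
        then show False using z(2) not_lex_le by blast
      qed
      ultimately have "h0 y = t" using lex_less_total by blast
      then show ?thesis using y(1) by blast
    qed
    then show "h ` seqs b = seqs b" using h h0(1) by (force simp: image_iff)
  qed
  then show ?thesis using adj h by (intro bexI[of _ h]) simp_all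
qed

text \<open>With \<open>Suc\<close>, even the block of the digit 0 starts with True and differs from
  an end mark at its first bit.\<close>

definition blocks :: "(nat \<Rightarrow> nat) \<Rightarrow> nat \<Rightarrow> bool list" where
  "blocks x n = concat (map (\<lambda>i. replicate (Suc (x i)) True @ [False]) [0..<n])"

text \<open>Each digit is written in unary and the final \<open>False\<close> marks the end, below every digit.\<close>

definition word_of :: "(nat \<Rightarrow> nat) \<Rightarrow> bool list" where
  "word_of x = blocks x (LEAST n. \<forall>i\<ge>n. x i = 0) @ [False]"

lemma blocks_Suc: "blocks x (Suc n) = blocks x n @ replicate (Suc (x n)) True @ [False]"
  by (simp add: blocks_def)

lemma blocks_agree: "agree n x y \<Longrightarrow> blocks x n = blocks y n"
  by (induction n) (auto simp: blocks_Suc agree_def, simp add: blocks_def)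

lemma blocks_prefix: "m \<le> n \<Longrightarrow> prefix (blocks x m) (blocks x n)"
proof (induction rule: dec_induct)
  case (step n)
  then show ?case unfolding blocks_Suc by (simp add: prefix_append)
qed simp

lemma left_of_word_of:
  assumes x: "x \<in> cuts b" and y: "y \<in> cuts b" and less: "lex_less x y"
  shows "left_of (word_of x) (word_of y)"
proof -
  have lengths: "\<exists>m. word_of z = blocks z m @ [False] \<and> (\<forall>i\<ge>m. z i = 0)" if "z \<in> cuts b" for z
  proof -
    have "\<exists>n. \<forall>i\<ge>n. z i = 0" using that by (metis cutsE)
    from LeastI_ex[OF this] show ?thesis unfolding word_of_def by blast
  qed
  obtain k where k: "word_of x = blocks x k @ [False]" "\<forall>i\<ge>k. x i = 0" using lengths[OF x] by blast
  obtain l where l: "word_of y = blocks y l @ [False]" "\<forall>i\<ge>l. y i = 0" using lengths[OF y] by blast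
  obtain n where n: "agree n x y" "x n < y n" using less unfolding lex_less_def by blast
  have "n < l" using l(2) n(2) by (metis not_less_zero not_le)
  have y_prefix: "prefix (blocks y (Suc j)) (word_of y)" if "j < l" for j
    unfolding l(1) using blocks_prefix[of "Suc j" l y] that by (simp add: prefix_append)
  show ?thesis
  proof (cases "n < k")
    case True
    define r where "r = blocks x n @ replicate (Suc (x n)) True"
    have "prefix (blocks x (Suc n)) (word_of x)"
      unfolding k(1) using blocks_prefix[of "Suc n" k x] True by (simp add: prefix_append)
    then have "prefix (r @ [False]) (word_of x)" by (simp add: r_def blocks_Suc)
    moreover have "prefix (r @ [True]) (word_of y)"
    proof (rule prefix_order.trans[OF _ y_prefix[OF \<open>n < l\<close>]])
      have "y n = Suc (x n) + (y n - Suc (x n))" using n(2) by simp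
      then have "replicate (Suc (y n)) True = replicate (Suc (x n)) True @ [True] @ replicate (y n - Suc (x n)) True"
        by (metis add_Suc_right replicate_add replicate_Suc append_Cons append_Nil)
      then show "prefix (r @ [True]) (blocks y (Suc n))"
        unfolding blocks_Suc r_def blocks_agree[OF n(1)] by (simp add: prefix_def)
    qed
    ultimately show ?thesis unfolding left_of_def by blast
  next
    \<comment> \<open>The code of \<open>x\<close> ends before the first difference, while
      \<open>y\<close> has a nonzero digit later. At the end mark of \<open>x\<close> the word of
      \<open>y\<close> opens a further block.\<close>
    case False
    then have "k < l" using \<open>n < l\<close> by simp
    have "prefix (blocks x k @ [True]) (blocks y (Suc k))"
      unfolding blocks_Suc using blocks_agree[OF agree_mono[OF n(1), of k]] False by (simp add: prefix_def)
    then have "prefix (blocks x k @ [True]) (word_of y)" using y_prefix[OF \<open>k < l\<close>] by (rule prefix_order.trans)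
    moreover have "prefix (blocks x k @ [False]) (word_of x)" unfolding k(1) by simp
    ultimately show ?thesis unfolding left_of_def by blast
  qed
qed

text \<open>The digit 1 after \<open>s\<close> makes the point nonzero even if \<open>s\<close>
  contains no True.\<close>

definition cut_of :: "bool list \<Rightarrow> nat \<Rightarrow> nat" where
  "cut_of s i = (if i < length s then of_bool (s ! i) else of_bool (i = length s))"

lemma cut_of_cuts: "2 \<le> b \<Longrightarrow> cut_of s \<in> cuts b"
proof (rule cutsI[of _ _ "Suc (length s)"])
  have "cut_of s (length s) = 1" by (simp add: cut_of_def)
  then show "cut_of s \<noteq> (\<lambda>_. 0)" by (metis zero_neq_one)
qed (auto simp: seqs_iff cut_of_def)

lemma left_of_cut_of:
  assumes "left_of s t" shows "lex_less (cut_of s) (cut_of t)"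
proof -
  obtain r u v where "s = r @ False # u" "t = r @ True # v"
    using assms by (auto simp: left_of_def prefix_def)
  then show ?thesis unfolding lex_less_def
    by (intro exI[of _ "length r"]) (auto simp: agree_def cut_of_def nth_append)
qed

section \<open>From Devlin's theorem to colourings of maps\<close>

lemma odd_tangent_eq: "odd_tangent j = real (tan_num (2 * j - 1))"
  by (simp add: odd_tangent_def deriv_tan_0)

lemma tan_num_odd_pos: "0 < tan_num (Suc (2 * j))"
proof (induction j)
  case (Suc j)
  define m where "m = Suc (Suc (2 * j))"
  \<comment> \<open>The summand with i = 1 alone is positive, by the induction hypothesis for m -
    1.\<close>
  have "0 < (m choose 1) * (tan_num 1 * tan_num (m - 1))"
    using Suc by (simp add: m_def del: tan_num.simps(2)) simp
  also have "\<dots> \<le> (\<Sum>i\<le>m. (m choose i) * (tan_num i * tan_num (m - i)))"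
    by (rule member_le_sum) (simp_all add: m_def)
  also have "\<dots> = tan_num (Suc m)" by (simp add: m_def del: sum.atMost_Suc)
  finally show ?case by (simp add: m_def del: tan_num.simps(2))
qed simp

text \<open>The level cuts are pulled back along \<open>f\<close>, which gives \<open>X\<close>, and
  then along \<open>h\<close>, which applies \<eta>. Distinct cuts stay distinct under
  \<open>f\<close> because it is onto.\<close>

lemma signature_compose:
  assumes b: "0 < b" and f: "f \<in> C_sur_mono b" and h: "h \<in> C_sur_mono b"
    and \<eta>: "\<forall>z\<in>cuts b. \<forall>y\<in>seqs b. lex_le z (h y) \<longleftrightarrow> lex_le (\<eta> z) y"
  shows "\<exists>X\<subseteq>cuts b. card X = b ^ k - 1 \<and>
    signature b k (compose (seqs b) f h) = (\<lambda>x. upper b (\<eta> x)) ` X"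
proof -
  have "\<exists>x\<in>cuts b. {y \<in> seqs b. lex_le z (f y)} = upper b x" if "z \<in> level_cuts b k" for z
    using preimage_upper[OF b f] that by (auto simp: cuts_def)
  then obtain \<xi> where \<xi>: "\<And>z. z \<in> level_cuts b k \<Longrightarrow> \<xi> z \<in> cuts b"
    "\<And>z. z \<in> level_cuts b k \<Longrightarrow> {y \<in> seqs b. lex_le z (f y)} = upper b (\<xi> z)"
    by metis
  have onto: "f ` seqs b = seqs b" using f unfolding C_sur_mono_iff by blast
  have "inj_on \<xi> (level_cuts b k)"
  proof (rule inj_onI)
    fix z w assume z: "z \<in> level_cuts b k" and w: "w \<in> level_cuts b k" and "\<xi> z = \<xi> w"
    then have "{y \<in> seqs b. lex_le z (f y)} = {y \<in> seqs b. lex_le w (f y)}" using \<xi>(2) by simp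
    then show "z = w" using inj_onD[OF inj_on_preimages[OF onto] _ z w] by blast
  qed
  then have "card (\<xi> ` level_cuts b k) = b ^ k - 1"
    using finite_card_level_cuts[OF b] by (simp add: card_image)
  moreover have "signature b k (compose (seqs b) f h) = (\<lambda>x. upper b (\<eta> x)) ` \<xi> ` level_cuts b k"
    unfolding signature_def image_image
  proof (rule image_cong[OF refl])
    fix z assume z: "z \<in> level_cuts b k"
    have hb: "h y \<in> seqs b" if "y \<in> seqs b" for y using h that unfolding C_sur_mono_iff by auto
    have "lex_le z (compose (seqs b) f h y) \<longleftrightarrow> lex_le (\<eta> (\<xi> z)) y" if y: "y \<in> seqs b" for y
    proof -
      have "lex_le z (compose (seqs b) f h y) \<longleftrightarrow> h y \<in> {y \<in> seqs b. lex_le z (f y)}"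
        using hb[OF y] y by (simp add: compose_def)
      also have "\<dots> \<longleftrightarrow> lex_le (\<xi> z) (h y)" unfolding \<xi>(2)[OF z] using hb[OF y] by (simp add: upper_def)
      also have "\<dots> \<longleftrightarrow> lex_le (\<eta> (\<xi> z)) y" using \<eta> \<xi>(1)[OF z] y by blast
      finally show ?thesis .
    qed
    then show "{y \<in> seqs b. lex_le z (compose (seqs b) f h y)} = upper b (\<eta> (\<xi> z))"
      unfolding upper_def by blast
  qed
  moreover have "\<xi> ` level_cuts b k \<subseteq> cuts b" using \<xi>(1) by blast
  ultimately show ?thesis by blast
qed

lemma rho_sup_le:
  assumes "0 < b" "\<And>y. y \<in> seqs b \<Longrightarrow> agree k (f y) (g y)"
  shows "rho_sup b f g \<le> (1 / 2) ^ k"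
  unfolding rho_sup_def using seqs_nonempty[OF assms(1)] assms(2) rho_le_iff by (intro cSUP_least) blast+

lemma approximate_coloring:
  fixes K :: nat
  assumes b: "2 \<le> b" and k: "0 < k" and K: "0 < K" and c: "c \<in> C_sur_mono b \<rightarrow> {..<K}"
  shows "\<exists>h\<in>C_sur_mono b. \<exists>B\<subseteq>{..<K}. card B \<le> tan_num (2 * (b ^ k - 1) - 1) \<and>
    (\<forall>f\<in>C_sur_mono b. \<exists>g\<in>C_sur_mono b. rho_sup b g (compose (seqs b) f h) \<le> (1 / 2) ^ k \<and> c g \<in> B)"
proof -
  have b0: "0 < b" using b by simp
  have "b \<le> b ^ k" using k b0 by (simp add: self_le_power)
  then have n: "0 < b ^ k - 1" using b by simp
  define fits where "fits A g \<longleftrightarrow> g \<in> C_sur_mono b \<and> signature b k g = (\<lambda>s. upper b (cut_of s)) ` A" for A g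
  \<comment> \<open>Maps with the same signature may differ in colour, so a representative is fixed.
    The default 0 is a legitimate colour because K > 0.\<close>
  define c' where "c' A = (if \<exists>g. fits A g then c (SOME g. fits A g) else 0)" for A
  have c'_SOME: "fits A (SOME g. fits A g)" if "fits A g" for A g using someI[of "fits A", OF that] .
  have "c' A < K" for A
  proof (cases "\<exists>g. fits A g")
    case True
    then have "fits A (SOME g. fits A g)" by (rule someI_ex)
    then have "(SOME g. fits A g) \<in> C_sur_mono b" by (simp add: fits_def)
    then show ?thesis using c True by (auto simp: c'_def)
  qed (use K in \<open>simp add: c'_def\<close>)
  then have range: "range c' \<subseteq> {..<K}" by auto
  then have "finite (range c')" using finite_subset by blast
  from Devlin[OF this n] obtain \<psi> B where \<psi>: "strong_emb \<psi>" and B: "B \<subseteq> range c'"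
    "card B \<le> tan_num (2 * (b ^ k - 1) - 1)"
    "\<And>U. card U = b ^ k - 1 \<Longrightarrow> diverging U \<Longrightarrow> c' (\<psi> ` sparse_node ` U) \<in> B"
    by metis
  \<comment> \<open>A copy of the order of cuts inside itself: cuts are coded as diverging words,
    made sparse, moved into the homogeneous subtree and read as cuts again, each step preserving the
    order from left to right.\<close>
  define \<eta> where "\<eta> x = cut_of (\<psi> (sparse_node (word_of x)))" for x
  have \<eta>_cuts: "\<eta> x \<in> cuts b" for x unfolding \<eta>_def using b by (rule cut_of_cuts)
  have \<eta>_mono: "lex_less (\<eta> x) (\<eta> y)" if "x \<in> cuts b" "y \<in> cuts b" "lex_less x y" for x y
    unfolding \<eta>_def
    by (intro left_of_cut_of left_of_strong_emb[OF \<psi>] left_of_sparse_node left_of_word_of[OF that])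
  obtain h where h: "h \<in> C_sur_mono b"
    "\<forall>z\<in>cuts b. \<forall>y\<in>seqs b. lex_le z (h y) \<longleftrightarrow> lex_le (\<eta> z) y"
    using dual_map[of b \<eta>, OF b0 \<eta>_cuts \<eta>_mono] by blast
  have "\<exists>g\<in>C_sur_mono b. rho_sup b g (compose (seqs b) f h) \<le> (1 / 2) ^ k \<and> c g \<in> B"
    if f: "f \<in> C_sur_mono b" for f
  proof -
    from signature_compose[OF b0 f h, of k] obtain X where X: "X \<subseteq> cuts b" "card X = b ^ k - 1"
      "signature b k (compose (seqs b) f h) = (\<lambda>x. upper b (\<eta> x)) ` X"
      by blast
    define A where "A = \<psi> ` sparse_node ` word_of ` X"
    have comp: "compose (seqs b) f h \<in> C_sur_mono b" using f h(1) by (rule compose_C_sur_mono)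
    then have "fits A (compose (seqs b) f h)"
      using X(3) by (simp add: fits_def A_def image_image \<eta>_def)
    then have g: "fits A (SOME g. fits A g)" "c' A = c (SOME g. fits A g)"
      using c'_SOME by (auto simp: c'_def)
    define g where "g = (SOME g. fits A g)"
    have gC: "g \<in> C_sur_mono b" "signature b k g = signature b k (compose (seqs b) f h)"
      using g(1) \<open>fits A (compose (seqs b) f h)\<close> by (simp_all add: fits_def g_def)
    have left: "left_of (word_of x) (word_of y) \<or> left_of (word_of y) (word_of x)"
      if "x \<in> X" "y \<in> X" "x \<noteq> y" for x y
      using lex_less_total[OF that(3)] left_of_word_of X(1) that(1,2) by blast
    have "\<not> left_of s s" for s unfolding left_of_def using not_prefix_snoc by blast
    then have "inj_on word_of X" using left by (intro inj_onI) metis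
    then have "card (word_of ` X) = b ^ k - 1" using X(2) by (simp add: card_image)
    moreover have "diverging (word_of ` X)" using left unfolding diverging_def by blast
    ultimately have "c' A \<in> B" unfolding A_def by (rule B(3))
    then have "c g \<in> B" using g(2) by (simp add: g_def)
    moreover have "rho_sup b g (compose (seqs b) f h) \<le> (1 / 2) ^ k"
      using signature_agree[OF b0 gC(1) comp gC(2)] by (intro rho_sup_le[OF b0])
    ultimately show ?thesis using gC(1) by blast
  qed
  moreover have "B \<subseteq> {..<K}" using B(1) range by blast
  ultimately show ?thesis using h(1) B(2) by blast
qed

theorem theorem1:
  fixes b :: nat
  assumes "b \<ge> 2"
  shows "\<forall>\<epsilon>::real. \<epsilon> > 0 \<longrightarrow>
    (\<exists>t::nat. t > 0 \<and>
      (\<epsilon> \<le> 1 \<longrightarrow> real t = odd_tangent (b ^ nat (\<lfloor>log 2 (1 / \<epsilon>)\<rfloor> + 1) - 1)) \<and>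
      (\<forall>K::nat. K > 0 \<longrightarrow>
        (\<forall>c \<in> C_sur_mono b \<rightarrow> {..<K}.
          \<exists>h\<in>C_sur_mono b. \<exists>B\<subseteq>{..<K}. card B \<le> t \<and>
            (\<forall>f\<in>C_sur_mono b. \<exists>g\<in>C_sur_mono b.
              rho_sup b g (compose (seqs b) f h) < \<epsilon> \<and> c g \<in> B))))"
proof (intro allI impI)
  fix \<epsilon> :: real assume \<epsilon>: "\<epsilon> > 0"
  have b0: "0 < b" using assms by simp
  let ?P = "\<lambda>t. \<forall>K::nat. K > 0 \<longrightarrow>
        (\<forall>c \<in> C_sur_mono b \<rightarrow> {..<K}.
          \<exists>h\<in>C_sur_mono b. \<exists>B\<subseteq>{..<K}. card B \<le> t \<and>
            (\<forall>f\<in>C_sur_mono b. \<exists>g\<in>C_sur_mono b.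
              rho_sup b g (compose (seqs b) f h) < \<epsilon> \<and> c g \<in> B))"
  show "\<exists>t::nat. t > 0 \<and> (\<epsilon> \<le> 1 \<longrightarrow> real t = odd_tangent (b ^ nat (\<lfloor>log 2 (1 / \<epsilon>)\<rfloor> + 1) - 1)) \<and> ?P t"
  proof (cases "\<epsilon> \<le> 1")
    case False
    \<comment> \<open>Distances never exceed 1 < \<epsilon>, so a single map \<open>h\<close>
      approximates every composition and one colour is enough.\<close>
    have "?P 1"
    proof (intro allI impI ballI)
      fix K :: nat and c assume c: "c \<in> C_sur_mono b \<rightarrow> {..<K}"
      define h where "h = restrict id (seqs b)"
      have h: "h \<in> C_sur_mono b" unfolding h_def by (rule id_C_sur_mono)
      have "rho_sup b h (compose (seqs b) f h) < \<epsilon>" for f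
        using rho_sup_le[OF b0, of 0 h "compose (seqs b) f h"] False by (simp add: agree_def)
      moreover have "{c h} \<subseteq> {..<K}" "card {c h} \<le> 1" using c h by auto
      ultimately show "\<exists>h\<in>C_sur_mono b. \<exists>B\<subseteq>{..<K}. card B \<le> 1 \<and>
            (\<forall>f\<in>C_sur_mono b. \<exists>g\<in>C_sur_mono b. rho_sup b g (compose (seqs b) f h) < \<epsilon> \<and> c g \<in> B)"
        using h by (intro bexI[of _ h] exI[of _ "{c h}"]) auto
    qed
    then show ?thesis using False by (intro exI[of _ 1]) simp
  next
    case True
    \<comment> \<open>The least k with 2^-k < \<epsilon>. The inequality must be strict because
      approximation yields distance at most 2^-k.\<close>
    define k where "k = nat (\<lfloor>log 2 (1 / \<epsilon>)\<rfloor> + 1)"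
    define n where "n = b ^ k - 1"
    have log: "0 \<le> log 2 (1 / \<epsilon>)" using \<epsilon> True by simp
    then have "0 < k" by (simp add: k_def)
    have "real k = of_int (\<lfloor>log 2 (1 / \<epsilon>)\<rfloor> + 1)" using log by (simp add: k_def)
    then have "log 2 (1 / \<epsilon>) < real k" by linarith
    then have "1 / \<epsilon> < 2 ^ k" using \<epsilon> by (simp add: log_less_iff powr_realpow)
    then have small: "(1 / 2) ^ k < \<epsilon>" using \<epsilon> by (simp add: field_simps power_divide)
    have "b \<le> b ^ k" using \<open>0 < k\<close> b0 by (simp add: self_le_power)
    then have "2 * n - 1 = Suc (2 * (n - 1))" using assms by (simp add: n_def)
    then have "0 < tan_num (2 * n - 1)" using tan_num_odd_pos[of "n - 1"] by simp
    moreover have "?P (tan_num (2 * n - 1))"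
    proof (intro allI impI ballI)
      fix K :: nat and c assume "0 < K" and c: "c \<in> C_sur_mono b \<rightarrow> {..<K}"
      then obtain h B where hB: "h \<in> C_sur_mono b" "B \<subseteq> {..<K}" "card B \<le> tan_num (2 * n - 1)"
        "\<And>f. f \<in> C_sur_mono b \<Longrightarrow> \<exists>g\<in>C_sur_mono b. rho_sup b g (compose (seqs b) f h) \<le> (1 / 2) ^ k \<and> c g \<in> B"
        using approximate_coloring[OF assms \<open>0 < k\<close>, of K c] unfolding n_def by blast
      have "\<exists>g\<in>C_sur_mono b. rho_sup b g (compose (seqs b) f h) < \<epsilon> \<and> c g \<in> B" if f: "f \<in> C_sur_mono b" for f
      proof -
        obtain g where "g \<in> C_sur_mono b" "rho_sup b g (compose (seqs b) f h) \<le> (1 / 2) ^ k" "c g \<in> B"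
          using hB(4)[OF f] by blast
        then show ?thesis using small by (meson le_less_trans)
      qed
      then show "\<exists>h\<in>C_sur_mono b. \<exists>B\<subseteq>{..<K}. card B \<le> tan_num (2 * n - 1) \<and>
            (\<forall>f\<in>C_sur_mono b. \<exists>g\<in>C_sur_mono b. rho_sup b g (compose (seqs b) f h) < \<epsilon> \<and> c g \<in> B)"
        using hB(1-3) by blast
    qed
    ultimately show ?thesis
      using odd_tangent_eq[of n] unfolding n_def k_def by (intro exI[of _ "tan_num (2 * n - 1)"]) (simp add: n_def k_def)
  qed
qed

end
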